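(* Let $m\ge 1$ and $n=2m+1$. Let $h\in\mathbb{R}[T]$ be a real polynomial and let $\mu_h=\varphi_h\circ\mu_0$. Then: (i) $\mu_h$ is a real circle form on $Y=W_2\times W_{2m+1}$; (ii) for $h,h'\in\mathbb{R}[T]$, the real circle forms $\mu_h$ and $\mu_{h'}$ are equivalent if and only if there exists $r\in\mathbb{R}^*$ such that $$h(T)\equiv r\,h'(r^2T) \pmod{T^m}.$$
   Context: For $k\ge1$, $W_k=\mathbb{C}^2$ is the $\mathbb{C}^*$-module with weights $(k,-k)$: $t\cdot(x,y)=(t^kx,t^{-k}y)$. Fix $m\ge1$, $n=2m+1$, and let $Y=W_2\times W_n\cong\mathbb{C}^4$ with coordinates $(a,b,x,y)$, so $t\cdot(a,b,x,y)=(t^2a,t^{-2}b,t^nx,t^{-n}y)$. Let $\sigma$ be the real form of $\mathbb{C}^*$ given by $\sigma(t)=\overline{t}^{-1}$. A real circle form on a $\mathbb{C}^*$-variety $Y$ is an antiholomorphic involution $\mu$ of $Y$ such that $\mu(t\cdot p)=\sigma(t)\cdot\mu(p)$ for all $t\in\mathbb{C}^*$, $p\in Y$. Two real circle forms $\mu_1,\mu_2$ are equivalent if there is a regular $\mathbb{C}^*$-equivariant automorphism $\psi$ of $Y$ with $\mu_2=\psi\circ\mu_1\circ\psi^{-1}$. Let $\mu_0(a,b,x,y)=(\overline{b},\overline{a},\overline{y},\overline{x})$. Set $T=ab$. For $h\in\mathbb{R}[T]$ let $$M_h=\begin{pmatrix}1-Th^2 & a^nh^n\\ -b^nh^n & \sum_{j=0}^{n-1}(Th^2)^j\end{pmatrix}\in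 GL_2(\mathbb{C}[a,b]),$$ where $h=h(T)=h(ab)$, and let $\varphi_h$ be the automorphism of $Y$ given by $\varphi_h(a,b,x,y)=\big(a,b,M_h\binom{x}{y}\big)$. *)

theory Defs
  imports Complex_Main "HOL-Computational_Algebra.Polynomial"
begin

text \<open>Points of Y = W_2 x W_n = C^4, coordinates (a,b,x,y).\<close>
type_synonym pt = "complex \<times> complex \<times> complex \<times> complex"

inductive_set regular_fun :: "(pt \<Rightarrow> complex) set" where
  const: "(\<lambda>p. c) \<in> regular_fun"
| coord_a: "(\<lambda>(a,b,x,y). a) \<in> regular_fun"
| coord_b: "(\<lambda>(a,b,x,y). b) \<in> regular_fun"
| coord_x: "(\<lambda>(a,b,x,y). x) \<in> regular_fun"
| coord_y: "(\<lambda>(a,b,x,y). y) \<in> regular_fun"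
| add: "f \<in> regular_fun \<Longrightarrow> g \<in> regular_fun \<Longrightarrow> (\<lambda>p. f p + g p) \<in> regular_fun"
| mult: "f \<in> regular_fun \<Longrightarrow> g \<in> regular_fun \<Longrightarrow> (\<lambda>p. f p * g p) \<in> regular_fun"

definition regular_map :: "(pt \<Rightarrow> pt) \<Rightarrow> bool" where
  "regular_map \<psi> \<longleftrightarrow>
     (\<lambda>p. fst (\<psi> p)) \<in> regular_fun \<and>
     (\<lambda>p. fst (snd (\<psi> p))) \<in> regular_fun \<and>
     (\<lambda>p. fst (snd (snd (\<psi> p)))) \<in> regular_fun \<and>
     (\<lambda>p. snd (snd (snd (\<psi> p)))) \<in> regular_fun"

definition regular_aut :: "(pt \<Rightarrow> pt) \<Rightarrow> bool" where
  "regular_aut \<psi> \<longleftrightarrow> bij \<psi> \<and> regular_map \<psi> \<and> regular_map (inv \<psi>)"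

definition conj_pt :: "pt \<Rightarrow> pt" where
  "conj_pt = (\<lambda>(a,b,x,y). (cnj a, cnj b, cnj x, cnj y))"

definition antiregular_map :: "(pt \<Rightarrow> pt) \<Rightarrow> bool" where
  "antiregular_map \<mu> \<longleftrightarrow> regular_map (\<mu> \<circ> conj_pt)"

definition act :: "nat \<Rightarrow> complex \<Rightarrow> pt \<Rightarrow> pt" where
  "act n t = (\<lambda>(a,b,x,y). (t^2 * a, inverse t ^ 2 * b, t^n * x, inverse t ^ n * y))"

definition sigma :: "complex \<Rightarrow> complex" where
  "sigma t = inverse (cnj t)"

definition real_circle_form :: "nat \<Rightarrow> (pt \<Rightarrow> pt) \<Rightarrow> bool" where
  "real_circle_form n \<mu> \<longleftrightarrow>
     antiregular_map \<mu> \<and> \<mu> \<circ> \<mu> = id \<and>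
     (\<forall>t p. t \<noteq> 0 \<longrightarrow> \<mu> (act n t p) = act n (sigma t) (\<mu> p))"

definition equivalent_forms :: "nat \<Rightarrow> (pt \<Rightarrow> pt) \<Rightarrow> (pt \<Rightarrow> pt) \<Rightarrow> bool" where
  "equivalent_forms n \<mu>1 \<mu>2 \<longleftrightarrow>
     (\<exists>\<psi>. regular_aut \<psi> \<and> (\<forall>t p. t \<noteq> 0 \<longrightarrow> \<psi> (act n t p) = act n t (\<psi> p)) \<and>
          \<mu>2 = \<psi> \<circ> \<mu>1 \<circ> inv \<psi>)"

definition mu0 :: "pt \<Rightarrow> pt" where
  "mu0 = (\<lambda>(a,b,x,y). (cnj b, cnj a, cnj y, cnj x))"

definition phi :: "nat \<Rightarrow> real poly \<Rightarrow> pt \<Rightarrow> pt" where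
  "phi n h = (\<lambda>(a,b,x,y).
     (let T = a * b; hv = poly (map_poly complex_of_real h) T in
      (a, b,
       (1 - T * hv^2) * x + a^n * hv^n * y,
       - (b^n * hv^n) * x + (\<Sum>j<n. (T * hv^2)^j) * y)))"

definition mu :: "nat \<Rightarrow> real poly \<Rightarrow> pt \<Rightarrow> pt" where
  "mu n h = phi n h \<circ> mu0"

end

theory Submission
  imports Defs "HOL-Computational_Algebra.Fundamental_Theorem_Algebra"
begin

text \<open>
  Write T = ab and \<open>\<tau>\<^sup>2 = T\<close>. On vectors (x, \<open>a\<^sup>n y\<close>) the matrix \<open>M\<^sub>h\<close> becomes the Gram matrix of a
  Hermitian form \<open>Q\<^sub>h\<close> over \<open>\<complex>[T]\<close> of determinant \<open>-T\<^sup>n\<close>, and equivalences that are linear over the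
  (a,b)-plane become isometries, triangular modulo \<open>T\<^sup>n\<close>, up to a constant factor.
  For real X, Y the value \<open>Q\<^sub>h(X,Y)\<close> is the norm from \<open>\<real>[\<tau>]\<close> to \<open>\<real>[T]\<close> of
  \<open>L = (1 - \<tau> h) X - \<tau>\<^sup>n c Y\<close>, \<open>c = (1 + \<tau>\<^sup>n h\<^sup>n) / (1 + \<tau> h)\<close>. So \<open>Q\<^sub>h\<close> is the restriction of
  \<open>|X|\<^sup>2 - T |Y|\<^sup>2\<close> to a lattice of colength m which only depends on h modulo \<open>T\<^sup>m\<close>; comparing the two bases
  of the lattice gives one implication. Conversely, an equivalence maps the plane x = y = 0 to itself
  by \<open>(a,b) \<mapsto> (\<lambda> a, cnj \<lambda> b)\<close>, and its normal derivative induces an isometry of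
  \<open>|X|\<^sup>2 - T |Y|\<^sup>2\<close> over \<open>\<complex>[T]\<close> up to a constant factor. That form is definite for T < 0, so
  the entries of the isometry are bounded there, whence it is a constant diagonal matrix. This forces
  h to agree modulo \<open>T\<^sup>m\<close> with the rescaled h' up to a phase, which is a sign because both are real.
\<close>

subsection \<open>Gram matrix identities\<close>

text \<open>Here P stands for \<open>T\<^sup>m\<close>, g for \<open>H\<^bsup>2m\<^esup>\<close> and S for the sum of \<open>(T H\<^sup>2)\<^sup>j\<close> over j < m; the primed
  letters belong to K. Since n = 2m + 1, the sum over j < n is S + P g (S + P g). The matrix
  (al, k; \<open>T\<^sup>n\<close> ga, de) is the base change from the basis of the lattice given by H to the one given by K.\<close>

lemma change_of_basis_identities:
  fixes T H S P g K S' g' k :: complex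
  assumes S: "(1 - T*H^2) * S = 1 - P*g" and S': "(1 - T*K^2) * S' = 1 - P*g'" and K: "K = H + P*k"
   and al: "al = S+P*g - T*H*K*S" and de: "de = S'+P*g' - T*H*K*S'" and ga: "ga = k*S*S' - (H*g'*S - K*g*S')"
  shows "al*de - T*P^2*k*ga = 1"
   "al*(1-T*H^2) - T*P^2*k*(H*g) = (1-T*K^2)*de + T*P^2*k*(K*g')"
   "al*(H*g) + k*(S+P*g*(S+P*g)) = (1-T*K^2)*ga + K*g'*al"
   "ga*(1-T*H^2) - de*(H*g) = (S'+P*g'*(S'+P*g'))*k - K*g'*de"
   "T*P^2*ga*(H*g) + de*(S+P*g*(S+P*g)) = (S'+P*g'*(S'+P*g'))*al - T*P^2*(K*g')*ga"
proof -
  show "al*de - T*P^2*k*ga = 1" using assms by algebra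
  show "al*(1-T*H^2) - T*P^2*k*(H*g) = (1-T*K^2)*de + T*P^2*k*(K*g')" using assms by algebra
  have "al*(H*g) + k*(S+P*g*(S+P*g)) = k*S+g*K*((1-T*H^2)*S+P*g)"
    unfolding al K by algebra
  also have "\<dots> = k*S + K*g" using S by algebra
  also have "\<dots> = k*S*(1-P*g') - H*g'*S*(1-T*K^2) + K*g*(1-P*g') + K*g'*al"
    unfolding al K by algebra
  also have "\<dots> = (1-T*K^2)*ga + K*g'*al" unfolding S'[symmetric] ga by algebra
  finally show "al*(H*g) + k*(S+P*g*(S+P*g)) = (1-T*K^2)*ga + K*g'*al" .
  have "ga*(1-T*H^2) - de*(H*g) = k*S'*(1-P*g) - H*g'*(1-P*g) + K*g*S'*(1-T*H^2) - de*(H*g)"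
    unfolding S[symmetric] ga by algebra
  also have "\<dots> = k*S' - H*g'" unfolding de K by algebra
  also have "\<dots> = k*S' - H*g'*((1-T*K^2)*S'+P*g')" using S' by algebra
  also have "\<dots> = (S'+P*g'*(S'+P*g'))*k - K*g'*de" unfolding de K by algebra
  finally show "ga*(1-T*H^2) - de*(H*g) = (S'+P*g'*(S'+P*g'))*k - K*g'*de" .
  \<comment> \<open>The remaining identity contains \<open>g\<close>, \<open>g'\<close> and
    \<open>ga\<close> only through \<open>P*g\<close>, \<open>P*g'\<close> and \<open>P*ga\<close>.
    Eliminating these three leaves a polynomial identity in \<open>T\<close>, \<open>H\<close>,
    \<open>K\<close>, \<open>S\<close>, \<open>S'\<close>.\<close>
  have Pg: "P*g = 1-S+T*H^2*S" and Pg': "P*g' = 1-S'+T*K^2*S'" using S S' by algebra+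
  have Pga: "P*ga = K*(1+T*H^2*S)*S' - H*(1+T*K^2*S')*S"
  proof -
    have "P*ga = (K-H)*S*S' - H*(P*g')*S + K*(P*g)*S'" unfolding ga K by algebra
    then show ?thesis unfolding Pg Pg' by algebra
  qed
  have "T*(P*ga)*(H*(P*g)+K*(P*g')) + de*(S+P*g*(S+P*g)) = (S'+P*g'*(S'+P*g'))*al"
    unfolding Pga al de Pg Pg' by algebra
  then show "T*P^2*ga*(H*g) + de*(S+P*g*(S+P*g)) = (S'+P*g'*(S'+P*g'))*al - T*P^2*(K*g')*ga"
    by algebra
qed

text \<open>Primed letters other than S' and g' stand for complex conjugates. The rows (X, Y) and
  P (Z, V) are the rows of A times the matrix embedding the H-lattice into the standard one.\<close>

lemma gram_matrix_transport:
  fixes T H S P g K S' g' al be ga de al' be' ga' de' :: complex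
  assumes S: "(1 - T*H^2) * S = 1 - P*g" and S': "(1 - T*K^2) * S' = 1 - P*g'"
    and P: "T \<noteq> 0" "P \<noteq> 0"
    and 1: "al*(1-T*H^2) - T*P^2*be*(H*g) = (1-T*K^2)*de' + T*P^2*be'*(K*g')"
    and 2: "al*(H*g) + be*(S+P*g*(S+P*g)) = (1-T*K^2)*ga' + K*g'*al'"
    and 3: "ga*(1-T*H^2) - de*(H*g) = (S'+P*g'*(S'+P*g'))*be' - K*g'*de'"
    and 4: "T*P^2*ga*(H*g) + de*(S+P*g*(S+P*g)) = (S'+P*g'*(S'+P*g'))*al' - T*P^2*(K*g')*ga'"
    and c': "al'*de' - T*P^2*be'*ga' = c'"
  defines "X \<equiv> al + be*T*P*H*S" and "X' \<equiv> al' + be'*T*P*H*S"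
    and "Y \<equiv> - al*H - be*P*(S+P*g)" and "Y' \<equiv> - al'*H - be'*P*(S+P*g)"
    and "Z \<equiv> T*P*ga + T*de*H*S" and "Z' \<equiv> T*P*ga' + T*de'*H*S"
    and "V \<equiv> - T*P*ga*H - de*(S+P*g)" and "V' \<equiv> - T*P*ga'*H - de'*(S+P*g)"
  shows "X*X' - T*(Y*Y') = c'*(1-T*K^2)" (is ?A)
    and "X*Z' - T*(Y*V') = - (T*P*(K*g')*c')" (is ?B)
    and "Z*X' - T*(V*Y') = - (T*P*(K*g')*c')" (is ?C)
    and "Z*Z' - T*(V*V') = - (T*(S'+P*g'*(S'+P*g'))*c')" (is ?D)
proof -
  \<comment> \<open>The basis of the H-lattice is \<open>(1, -H)\<close> and
    \<open>(T*P*H*S, -P*(S+P*g))\<close>. The norm of the second vector is \<open>-T*P^2\<close>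
    times the left side; the right side is the lower right entry of \<open>M_h\<close>.\<close>
  have *: "(S+P*g)^2 - T*H^2*S^2 = S+P*g*(S+P*g)" using S by algebra
  have "X*X' - T*(Y*Y') = al'*(al*(1-T*H^2) - T*P^2*be*(H*g))
    - T*P^2*be'*(al*(H*g) + be*(S+P*g*(S+P*g)))"
    unfolding *[symmetric] X_def X'_def Y_def Y'_def by algebra
  also have "\<dots> = c'*(1-T*K^2)" unfolding 1 2 c'[symmetric] by algebra
  finally show ?A .
  have "P*(X*Z' - T*(Y*V')) = T*P^2*ga'*(al*(1-T*H^2) - T*P^2*be*(H*g))
    - T*P^2*de'*(al*(H*g) + be*(S+P*g*(S+P*g)))"
    unfolding *[symmetric] X_def Z'_def Y_def V'_def by algebra
  also have "\<dots> = P*(- (T*P*(K*g')*c'))" unfolding 1 2 c'[symmetric] by algebra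
  finally show ?B using P(2) mult_left_cancel by blast
  have "P*(Z*X' - T*(V*Y')) = T*P^2*al'*(ga*(1-T*H^2) - de*(H*g))
    - T*P^2*be'*(T*P^2*ga*(H*g) + de*(S+P*g*(S+P*g)))"
    unfolding *[symmetric] X'_def Z_def Y'_def V_def by algebra
  also have "\<dots> = P*(- (T*P*(K*g')*c'))" unfolding 3 4 c'[symmetric] by algebra
  finally show ?C using P(2) mult_left_cancel by blast
  have "P^2*(Z*Z' - T*(V*V')) = T^2*P^4*ga'*(ga*(1-T*H^2) - de*(H*g))
    - T*P^2*de'*(T*P^2*ga*(H*g) + de*(S+P*g*(S+P*g)))"
    unfolding *[symmetric] Z_def Z'_def V_def V'_def by algebra
  also have "\<dots> = P^2*(- (T*(S'+P*g'*(S'+P*g'))*c'))" unfolding 3 4 c'[symmetric] by algebra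
  finally show ?D using P(2) mult_left_cancel power_not_zero by blast
qed

text \<open>The matrix with rows \<open>(1, -K)\<close> and \<open>(T*K*S', -(S'+P*g'))\<close>,
  which embeds the K-lattice up to the factor \<open>P\<close> in its second row, has determinant
  -1. Its inverse has rows \<open>(S'+P*g', -K)\<close> and \<open>(T*K*S', -1)\<close>. Applying
  this inverse to the rows \<open>(X, Y)\<close> and \<open>(Z, V)\<close> turns their Gram matrix
  into \<open>c'\<close> times diag(1, -T).\<close>

lemma unimodular_gram_matrix:
  fixes T K S' P g' X X' Y Y' Z Z' V V' c' :: complex
  assumes S': "(1 - T*K^2) * S' = 1 - P*g'"
    and A: "X*X' - T*(Y*Y') = c'*(1-T*K^2)"
    and B: "X*Z' - T*(Y*V') = - (T*P*(K*g')*c')"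
    and C: "Z*X' - T*(V*Y') = - (T*P*(K*g')*c')"
    and D: "Z*Z' - T*(V*V') = - (T*(S'+P*g'*(S'+P*g'))*c')"
  shows "((S'+P*g')*X - K*Z)*((S'+P*g')*X' - K*Z') - T*(((S'+P*g')*Y-K*V)*((S'+P*g')*Y'-K*V')) = c'"
   "(T*K*S'*X-Z)*(T*K*S'*X'-Z') - T*((T*K*S'*Y-V)*(T*K*S'*Y'-V')) = -T*c'"
proof -
  have *: "S'+P*g'*(S'+P*g') = (S'+P*g')^2 - T*K^2*S'^2" using S' by algebra
  have 1: "(S'+P*g') - T*K^2*S' = 1" using S' by algebra
  let ?s = "S'+P*g'"
  have "(?s*X - K*Z)*(?s*X' - K*Z') - T*((?s*Y-K*V)*(?s*Y'-K*V'))
    = ?s^2*(X*X' - T*(Y*Y')) - K*?s*(X*Z' - T*(Y*V')) - K*?s*(Z*X' - T*(V*Y')) + K^2*(Z*Z' - T*(V*V'))"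
    by algebra
  also have "\<dots> = c' * (?s^2*(1-T*K^2) + 2*K*?s*T*P*(K*g') - K^2*T*(?s^2 - T*K^2*S'^2))"
    unfolding A B C D * by algebra
  also have "(?s^2*(1-T*K^2) + 2*K*?s*T*P*(K*g') - K^2*T*(?s^2 - T*K^2*S'^2)) = (?s - T*K^2*S')^2"
    by algebra
  finally show "(?s*X - K*Z)*(?s*X' - K*Z') - T*((?s*Y-K*V)*(?s*Y'-K*V')) = c'"
    unfolding 1 by simp
  let ?q = "T*K*S'"
  have "(?q*X - Z)*(?q*X' - Z') - T*((?q*Y-V)*(?q*Y'-V'))
    = ?q^2*(X*X' - T*(Y*Y')) - ?q*(X*Z' - T*(Y*V')) - ?q*(Z*X' - T*(V*Y')) + (Z*Z' - T*(V*V'))"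
    by algebra
  also have "\<dots> = -T*c' * (?s^2 - T*K^2*S'^2 - 2*K*S'*T*P*(K*g') - K^2*S'^2*T*(1-T*K^2))"
    unfolding A B C D * by algebra
  also have "(?s^2 - T*K^2*S'^2 - 2*K*S'*T*P*(K*g') - K^2*S'^2*T*(1-T*K^2)) = (?s - T*K^2*S')^2"
    by algebra
  finally show "(?q*X-Z)*(?q*X'-Z') - T*((?q*Y-V)*(?q*Y'-V')) = -T*c'"
    unfolding 1 by simp
qed

subsection \<open>Equivariant regular maps\<close>

lemma regular_coords:
  "(\<lambda>p. fst p) \<in> regular_fun" "(\<lambda>p. fst (snd p)) \<in> regular_fun"
  "(\<lambda>p. fst (snd (snd p))) \<in> regular_fun" "(\<lambda>p. snd (snd (snd p))) \<in> regular_fun"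
proof -
  note subst_in = back_subst[of "\<lambda>f. f \<in> regular_fun"]
  show "(\<lambda>p. fst p) \<in> regular_fun"
    by (rule subst_in[OF regular_fun.coord_a]) (simp add: fun_eq_iff)
  show "(\<lambda>p. fst (snd p)) \<in> regular_fun"
    by (rule subst_in[OF regular_fun.coord_b]) (simp add: fun_eq_iff)
  show "(\<lambda>p. fst (snd (snd p))) \<in> regular_fun"
    by (rule subst_in[OF regular_fun.coord_x]) (simp add: fun_eq_iff)
  show "(\<lambda>p. snd (snd (snd p))) \<in> regular_fun"
    by (rule subst_in[OF regular_fun.coord_y]) (simp add: fun_eq_iff)
qed

lemma regular_power: "f \<in> regular_fun \<Longrightarrow> (\<lambda>p. f p ^ k) \<in> regular_fun"
  by (induction k) (auto intro: regular_fun.const regular_fun.mult)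

lemma regular_poly: "f \<in> regular_fun \<Longrightarrow> (\<lambda>p. poly P (f p)) \<in> regular_fun"
  by (induction P) (auto intro: regular_fun.const regular_fun.mult regular_fun.add)

lemmas regular_intros = regular_coords regular_fun.const regular_fun.add regular_fun.mult
  regular_power regular_poly

lemma regular_fun_compose:
  assumes "f \<in> regular_fun" "regular_map \<psi>"
  shows "(\<lambda>p. f (\<psi> p)) \<in> regular_fun"
  using assms(1)
  by induction (use assms(2) in \<open>auto simp: regular_map_def case_prod_unfold intro: regular_intros\<close>)

lemma regular_map_compose: "regular_map f \<Longrightarrow> regular_map g \<Longrightarrow> regular_map (f \<circ> g)"
  unfolding o_def regular_map_def[of f] regular_map_def[of "\<lambda>x. f (g x)"]
  by (intro conjI regular_fun_compose[of "\<lambda>p. fst (f p)" g] regular_fun_compose[of "\<lambda>p. fst (snd (f p))" g]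
     regular_fun_compose[of "\<lambda>p. fst (snd (snd (f p)))" g]
     regular_fun_compose[of "\<lambda>p. snd (snd (snd (f p)))" g]) auto

lemma regular_aut_compose:
  "regular_aut f \<Longrightarrow> regular_aut g \<Longrightarrow> regular_aut (f \<circ> g)"
  unfolding regular_aut_def by (metis bij_comp o_inv_distrib regular_map_compose)

lemma regular_autI:
  assumes "regular_map f" "regular_map g" "f \<circ> g = id" "g \<circ> f = id"
  shows "regular_aut f"
  unfolding regular_aut_def using assms o_bij inv_unique_comp by metis

lemma equivalent_formsI:
  assumes "regular_aut \<psi>" "\<And>t p. t \<noteq> 0 \<Longrightarrow> \<psi> (act n t p) = act n t (\<psi> p)"
    and "\<psi> \<circ> \<mu>1 = \<mu>2 \<circ> \<psi>"
  shows "equivalent_forms n \<mu>1 \<mu>2"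
proof -
  have "\<psi> \<circ> \<mu>1 \<circ> inv \<psi> = \<mu>2 \<circ> (\<psi> \<circ> inv \<psi>)" unfolding assms(3) by (simp add: o_assoc)
  also have "\<psi> \<circ> inv \<psi> = id"
    using assms(1) unfolding regular_aut_def by (meson bij_is_surj surj_iff)
  finally have "\<mu>2 = \<psi> \<circ> \<mu>1 \<circ> inv \<psi>" by (simp only: comp_id)
  with assms(1,2) show ?thesis unfolding equivalent_forms_def by blast
qed

text \<open>The factors \<open>a^n\<close> and \<open>b^n\<close> carry the weights 2n and -2n that
  equivariance demands of the off-diagonal entries; the other factors depend on the invariant
  \<open>a*b\<close> alone.\<close>

definition fibre_map :: "nat \<Rightarrow> complex poly \<Rightarrow> complex poly \<Rightarrow> complex poly \<Rightarrow> complex poly \<Rightarrow> pt \<Rightarrow> pt" where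
  "fibre_map n \<alpha> \<beta> \<gamma> \<delta> = (\<lambda>(a,b,x,y).
     (a, b, poly \<alpha> (a*b) * x + a^n * poly \<beta> (a*b) * y, b^n * poly \<gamma> (a*b) * x + poly \<delta> (a*b) * y))"

lemma regular_map_fibre_map: "regular_map (fibre_map n \<alpha> \<beta> \<gamma> \<delta>)"
  unfolding regular_map_def fibre_map_def by (auto simp: case_prod_unfold intro!: regular_intros)

lemma fibre_map_act:
  assumes "t \<noteq> 0"
  shows "fibre_map n \<alpha> \<beta> \<gamma> \<delta> (act n t p) = act n t (fibre_map n \<alpha> \<beta> \<gamma> \<delta> p)"
proof -
  obtain a b x y where p: "p = (a,b,x,y)" by (cases p) auto
  have 1: "t\<^sup>2 * (inverse t)\<^sup>2 = 1"
    using assms by (simp add: field_simps)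
  have 2: "(t\<^sup>2 * a)^n * inverse t ^n = t^n * a^n" "((inverse t)\<^sup>2 * b)^n * t ^n = inverse t^n * b^n"
  proof -
    have "t\<^sup>2 * a * inverse t = t * a" "(inverse t)\<^sup>2 * b * t = inverse t * b"
      using assms by (simp_all add: power2_eq_square field_simps)
    then show "(t\<^sup>2 * a)^n * inverse t ^n = t^n * a^n" "((inverse t)\<^sup>2 * b)^n * t ^n = inverse t^n * b^n"
      by (metis power_mult_distrib)+
  qed
  have "fibre_map n \<alpha> \<beta> \<gamma> \<delta> (act n t p) = (t\<^sup>2*a, (inverse t)\<^sup>2*b,
      poly \<alpha> (a*b) * (t^n*x) + ((t\<^sup>2*a)^n * inverse t ^n) * poly \<beta> (a*b) * y,
      (((inverse t)\<^sup>2 * b)^n * t ^n) * poly \<gamma> (a*b) * x + poly \<delta> (a*b) * (inverse t^n * y))"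
    by (simp add: p fibre_map_def act_def 1 mult_ac)
  then show ?thesis unfolding 2 by (simp add: p fibre_map_def act_def algebra_simps)
qed

lemma det_one_inverse:
  fixes A :: complex
  assumes "A * D - B * C = 1"
  shows "A * (D * x - B * y) + B * (A * y - C * x) = x"
    and "C * (D * x - B * y) + D * (A * y - C * x) = y"
  using assms by algebra+

lemma fibre_map_inverse:
  assumes "\<alpha> * \<delta> - monom 1 n * \<beta> * \<gamma> = 1"
  shows "fibre_map n \<alpha> \<beta> \<gamma> \<delta> \<circ> fibre_map n \<delta> (-\<beta>) (-\<gamma>) \<alpha> = id"
proof
  fix p :: pt
  obtain a b x y where p: "p = (a,b,x,y)" by (cases p) auto
  define A B C D where "A = poly \<alpha> (a*b)" "B = poly \<beta> (a*b)" "C = poly \<gamma> (a*b)" "D = poly \<delta> (a*b)"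
  have "A * D - (a*b)^n * B * C = 1"
    using arg_cong[OF assms, of "\<lambda>P. poly P (a*b)"] by (simp add: A_B_C_D_def poly_monom)
  then have "A * D - (a^n * B) * (b^n * C) = 1" by (simp add: power_mult_distrib mult_ac)
  from det_one_inverse[OF this, of x y]
  show "(fibre_map n \<alpha> \<beta> \<gamma> \<delta> \<circ> fibre_map n \<delta> (-\<beta>) (-\<gamma>) \<alpha>) p = id p"
    by (simp add: p fibre_map_def flip: A_B_C_D_def)
qed

lemma regular_aut_fibre_map:
  assumes "\<alpha> * \<delta> - monom 1 n * \<beta> * \<gamma> = 1"
  shows "regular_aut (fibre_map n \<alpha> \<beta> \<gamma> \<delta>)"
proof (rule regular_autI[OF regular_map_fibre_map regular_map_fibre_map])
  show "fibre_map n \<alpha> \<beta> \<gamma> \<delta> \<circ> fibre_map n \<delta> (-\<beta>) (-\<gamma>) \<alpha> = id" using assms by (rule fibre_map_inverse)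
  show "fibre_map n \<delta> (-\<beta>) (-\<gamma>) \<alpha> \<circ> fibre_map n \<alpha> \<beta> \<gamma> \<delta> = id"
    using fibre_map_inverse[of \<delta> \<alpha> n "-\<beta>" "-\<gamma>"] assms by (simp add: mult.commute)
qed

section \<open>The maps \<open>mu n h\<close> as real circle forms\<close>

lemma phi_eq_fibre_map:
  fixes h :: "real poly"
  defines "H \<equiv> map_poly complex_of_real h"
  shows "phi n h = fibre_map n (1 - [:0,1:] * H^2) (H^n) (- (H^n)) (\<Sum>j<n. ([:0,1:] * H^2)^j)"
  by (auto simp: phi_def fibre_map_def H_def Let_def poly_sum fun_eq_iff)

lemma geometric_sum: "(1 - z) * (\<Sum>j<k. z^j) = 1 - (z::'a::comm_ring_1)^k"
  by (simp add: one_diff_power_eq)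

lemma det_phi:
  fixes H :: complex
  assumes "odd n"
  shows "(1 - T*H^2) * (\<Sum>j<n. (T*H^2)^j) - T^n * H^n * (- (H^n)) = 1"
  unfolding geometric_sum by (simp add: power_mult_distrib power2_eq_square)

lemma cnj_poly_of_real: "cnj (poly (map_poly complex_of_real h) z) = poly (map_poly complex_of_real h) (cnj z)"
  by (rule poly_cnj_real) (simp add: coeff_map_poly)

lemma antiregular_mu: "antiregular_map (mu n h)"
proof -
  have "regular_map (mu0 \<circ> conj_pt)"
    unfolding regular_map_def mu0_def conj_pt_def by (auto simp: case_prod_unfold intro!: regular_intros)
  then show ?thesis
    unfolding antiregular_map_def mu_def phi_eq_fibre_map
    using regular_map_compose[OF regular_map_fibre_map] by (simp add: comp_assoc)
qed

text \<open>Conjugating \<open>phi n h\<close> by \<open>mu0\<close> swaps the diagonal entries of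
  the matrix and, \<open>h\<close> being real, changes the sign of the off-diagonal ones. This is
  the adjugate, hence the inverse, because the determinant is 1.\<close>

lemma mu_involution: assumes "odd n" shows "mu n h \<circ> mu n h = id"
proof
  fix p :: pt
  obtain a b x y where p: "p = (a,b,x,y)" by (cases p) auto
  define H where "H = poly (map_poly complex_of_real h) (a*b)"
  define s where "s = (\<Sum>j<n. (a*b*H^2)^j)"
  have "(1 - a*b*H^2) * s - (a*b)^n * H^n * (-(H^n)) = 1"
    unfolding s_def by (rule det_phi[OF assms])
  then have "(1 - a*b*H^2) * s - (a^n * H^n) * (- (b^n * H^n)) = 1"
    by (simp add: power_mult_distrib mult_ac)
  from det_one_inverse[OF this, of x y]
  show "(mu n h \<circ> mu n h) p = id p"
    by (simp add: mu_def mu0_def phi_def Let_def p cnj_poly_of_real mult.commute[of b a]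
       flip: H_def s_def)
qed

lemma mu0_act: "t \<noteq> 0 \<Longrightarrow> mu0 (act n t p) = act n (sigma t) (mu0 p)"
  by (cases p) (simp add: mu0_def act_def sigma_def)

lemma mu_act: "t \<noteq> 0 \<Longrightarrow> mu n h (act n t p) = act n (sigma t) (mu n h p)"
  unfolding mu_def phi_eq_fibre_map by (simp add: mu0_act fibre_map_act sigma_def)

lemma real_circle_form_mu: "odd n \<Longrightarrow> real_circle_form n (mu n h)"
  unfolding real_circle_form_def by (simp add: antiregular_mu mu_involution mu_act)

subsection \<open>Constructing equivalences\<close>

lemma map_poly_of_real_add:
  "map_poly complex_of_real (p + q) = map_poly complex_of_real p + map_poly complex_of_real q"
  by (rule poly_eqI) (simp add: coeff_map_poly)

lemma map_poly_of_real_mult: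
  "map_poly complex_of_real (p * q) = map_poly complex_of_real p * map_poly complex_of_real q"
  by (rule poly_eqI) (simp add: coeff_map_poly coeff_mult)

lemma map_poly_of_real_smult:
  "map_poly complex_of_real (smult c p) = smult (complex_of_real c) (map_poly complex_of_real p)"
  by (rule poly_eqI) (simp add: coeff_map_poly)

lemma map_poly_of_real_pcompose:
  "map_poly complex_of_real (pcompose p q) = pcompose (map_poly complex_of_real p) (map_poly complex_of_real q)"
  by (induction p) (simp_all add: map_poly_pCons pcompose_pCons map_poly_of_real_add map_poly_of_real_mult)

definition rescale :: "real \<Rightarrow> real poly \<Rightarrow> real poly" where
  "rescale r h = smult r (pcompose h [:0, r^2:])"

lemma poly_rescale:
  "poly (map_poly complex_of_real (rescale r h)) z
    = complex_of_real r * poly (map_poly complex_of_real h) ((complex_of_real r)^2 * z)"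
  by (simp add: rescale_def map_poly_of_real_smult map_poly_of_real_pcompose poly_pcompose
      map_poly_pCons mult.commute)

definition dilation :: "real \<Rightarrow> pt \<Rightarrow> pt" where
  "dilation r = (\<lambda>(a,b,x,y). (of_real r * a, of_real r * b, x, y))"

lemma regular_aut_dilation:
  assumes "r \<noteq> 0"
  shows "regular_aut (dilation r)"
proof (rule regular_autI)
  show "regular_map (dilation r)" "regular_map (dilation (inverse r))"
    unfolding regular_map_def dilation_def by (auto simp: case_prod_unfold intro!: regular_intros)
  show "dilation r \<circ> dilation (inverse r) = id" "dilation (inverse r) \<circ> dilation r = id"
    using assms by (auto simp: dilation_def fun_eq_iff field_simps)
qed

lemma dilation_act: "dilation r (act n t p) = act n t (dilation r p)"
  by (cases p) (simp add: dilation_def act_def)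

text \<open>For real \<open>r\<close> the dilation commutes with \<open>mu0\<close> and multiplies T
  by \<open>r^2\<close>. The outer factor \<open>r\<close> in \<open>rescale\<close> accounts for
  the power of \<open>r\<close> that the dilation produces in \<open>a^n\<close>, \<open>b^n\<close>
  and \<open>T*H^2\<close>.\<close>

lemma dilation_mu: "dilation r \<circ> mu n (rescale r h) = mu n h \<circ> dilation r"
proof
  fix p :: pt
  obtain a b x y where p: "p = (a,b,x,y)" by (cases p) auto
  have "(complex_of_real r)^2 * (cnj b * cnj a) = complex_of_real r * cnj b * (complex_of_real r * cnj a)"
    by (simp add: power2_eq_square)
  then show "(dilation r \<circ> mu n (rescale r h)) p = (mu n h \<circ> dilation r) p"
    by (simp add: p dilation_def mu_def mu0_def phi_def Let_def poly_rescale power_mult_distrib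
      power2_eq_square mult_ac)
qed

text \<open>Conjugation by \<open>mu0\<close> exchanges \<alpha> with \<delta> and \<beta> with
  \<gamma>, since all four are real. The equations in \<open>eqs\<close> are then the four entries
  of the matrix form of the intertwining relation, freed of the common factors \<open>a^n\<close>
  and \<open>b^n\<close> of the off-diagonal entries.\<close>

lemma fibre_map_mu:
  fixes h k :: "real poly"
  assumes real: "\<And>z. cnj (poly \<alpha> z) = poly \<alpha> (cnj z)" "\<And>z. cnj (poly \<beta> z) = poly \<beta> (cnj z)"
    "\<And>z. cnj (poly \<gamma> z) = poly \<gamma> (cnj z)" "\<And>z. cnj (poly \<delta> z) = poly \<delta> (cnj z)"
    and eqs: "\<And>T. let H = poly (map_poly complex_of_real h) T; K = poly (map_poly complex_of_real k) T;
       al = poly \<alpha> T; be = poly \<beta> T; ga = poly \<gamma> T; de = poly \<delta> T;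
       s = (\<Sum>j<n. (T * H^2)^j); s' = (\<Sum>j<n. (T * K^2)^j) in
     al*(1-T*H^2) - T^n*be*H^n = (1-T*K^2)*de + T^n*be*K^n \<and>
     al*H^n + be*s = (1-T*K^2)*ga + K^n*al \<and>
     ga*(1-T*H^2) - de*H^n = s'*be - K^n*de \<and>
     T^n*ga*H^n + de*s = s'*al - T^n*K^n*ga"
  shows "fibre_map n \<alpha> \<beta> \<gamma> \<delta> \<circ> mu n h = mu n k \<circ> fibre_map n \<alpha> \<beta> \<gamma> \<delta>"
proof
  fix p :: pt
  obtain a b x y where p: "p = (a,b,x,y)" by (cases p) auto
  define a' b' x' y' where "a' = cnj b" "b' = cnj a" "x' = cnj y" "y' = cnj x"
  note prime = this
  define T H K where "T = a' * b'" and "H = poly (map_poly complex_of_real h) T"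
    and "K = poly (map_poly complex_of_real k) T"
  define al be ga de where "al = poly \<alpha> T" "be = poly \<beta> T" "ga = poly \<gamma> T" "de = poly \<delta> T"
  note vals = this
  define s s' where "s = (\<Sum>j<n. (T * H^2)^j)" and "s' = (\<Sum>j<n. (T * K^2)^j)"
  define A B Hn Kn where "A = a' ^ n" "B = b' ^ n" "Hn = H ^ n" "Kn = K ^ n"
  note pows = this
  have Tn: "T ^ n = A * B" by (simp add: T_def pows power_mult_distrib)
  have 1: "al*(1-T*H^2) - A*B*be*Hn = (1-T*K^2)*de + A*B*be*Kn"
    and 2: "al*Hn + be*s = (1-T*K^2)*ga + Kn*al"
    and 3: "ga*(1-T*H^2) - de*Hn = s'*be - Kn*de"
    and 4: "A*B*ga*Hn + de*s = s'*al - A*B*Kn*ga"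
    using eqs[of T] unfolding Let_def
    by (simp_all add: Tn flip: vals H_def K_def s_def s'_def pows)
  have "al*((1-T*H^2)*x' + A*Hn*y') + A*be*(s*y' - B*Hn*x')
     = (1-T*K^2)*(de*x' + A*ga*y') + A*Kn*(al*y' + B*be*x')"
    using 1 2 by algebra
  moreover have "B*ga*((1-T*H^2)*x' + A*Hn*y') + de*(s*y' - B*Hn*x')
     = s'*(al*y' + B*be*x') - B*Kn*(de*x' + A*ga*y')"
    using 3 4 by algebra
  moreover have "mu n h p = (a', b', (1-T*H^2)*x' + A*Hn*y', s*y' - B*Hn*x')"
    by (simp add: p mu_def mu0_def phi_def Let_def flip: prime T_def H_def s_def pows)
  moreover have "mu0 (fibre_map n \<alpha> \<beta> \<gamma> \<delta> p) = (a', b', de*x' + A*ga*y', al*y' + B*be*x')"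
  proof -
    have "cnj (a * b) = T" by (simp add: T_def prime mult.commute)
    then show ?thesis
      by (simp add: p fibre_map_def mu0_def real vals pows prime algebra_simps)
  qed
  moreover have "phi n k (a', b', u, v) = (a', b', (1-T*K^2)*u + A*Kn*v, s'*v - B*Kn*u)" for u v
    by (simp add: phi_def Let_def flip: T_def K_def s'_def pows)
  moreover have "fibre_map n \<alpha> \<beta> \<gamma> \<delta> (a', b', u, v) = (a', b', al*u + A*be*v, B*ga*u + de*v)" for u v
    by (simp add: fibre_map_def flip: T_def vals pows)
  ultimately show "(fibre_map n \<alpha> \<beta> \<gamma> \<delta> \<circ> mu n h) p = (mu n k \<circ> fibre_map n \<alpha> \<beta> \<gamma> \<delta>) p"
    by (simp add: mu_def)
qed

lemma geometric_sum_split: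
  fixes z :: "'a::comm_semiring_1"
  shows "(\<Sum>j<m+k. z^j) = (\<Sum>j<m. z^j) + z^m * (\<Sum>j<k. z^j)"
  by (induction k) (simp_all add: power_add distrib_left add.assoc)

lemma geometric_sum_odd:
  fixes z :: "'a::comm_semiring_1"
  shows "(\<Sum>j<2*m+1. z^j) = (\<Sum>j<m. z^j) + z^m * ((\<Sum>j<m. z^j) + z^m)"
  using geometric_sum_split[of z m "m+1"] by (simp add: mult_2)

text \<open>Since \<open>h\<close> and \<open>k\<close> agree modulo \<open>T^m\<close>, their
  lattices coincide. The equivalence is the change between the two bases, over the identity of the
  (a,b)-plane.\<close>

lemma fibre_equivalence:
  fixes h k \<kappa> :: "real poly"
  assumes n: "n = 2*m+1" and k: "k = h + monom 1 m * \<kappa>"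
  shows "\<exists>\<psi>. regular_aut \<psi> \<and> (\<forall>t p. t \<noteq> 0 \<longrightarrow> \<psi> (act n t p) = act n t (\<psi> p)) \<and> \<psi> \<circ> mu n h = mu n k \<circ> \<psi>"
proof -
  define c where "c = map_poly complex_of_real"
  define X :: "complex poly" where "X = [:0,1:]"
  define S S' where "S = (\<Sum>j<m. (X * (c h)^2)^j)" and "S' = (\<Sum>j<m. (X * (c k)^2)^j)"
  \<comment> \<open>These are \<open>al\<close>, \<open>k\<close>, \<open>ga\<close> and
    \<open>de\<close> of \<open>change_of_basis_identities\<close> for \<open>P = X^m\<close>,
    \<open>g = c h^(2*m)\<close> and \<open>g' = c k^(2*m)\<close>.\<close>
  define \<alpha> \<beta> \<gamma> \<delta> where "\<alpha> = S + X^m * c h^(2*m) - X * c h * c k * S"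
    "\<beta> = c \<kappa>" "\<gamma> = c \<kappa> * S * S' - (c h * c k^(2*m) * S - c k * c h^(2*m) * S')"
    "\<delta> = S' + X^m * c k^(2*m) - X * c h * c k * S'"
  note greek = this
  have ck: "poly (c k) T = poly (c h) T + T^m * poly (c \<kappa>) T" for T
    by (simp add: k c_def map_poly_of_real_add map_poly_of_real_mult map_poly_monom poly_monom)
  have pS: "poly S T = (\<Sum>j<m. (T * (poly (c h) T)^2)^j)" "poly S' T = (\<Sum>j<m. (T * (poly (c k) T)^2)^j)" for T
    by (simp_all add: S_def S'_def X_def poly_sum)
  have geo: "(1 - T * z^2) * (\<Sum>j<m. (T*z^2)^j) = 1 - T^m * z^(2*m)" for T z :: complex
    unfolding geometric_sum by (simp add: power_mult_distrib power_mult)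
  have geo': "(\<Sum>j<n. (T*z^2)^j) = (\<Sum>j<m. (T*z^2)^j) + T^m * z^(2*m) * ((\<Sum>j<m. (T*z^2)^j) + T^m * z^(2*m))"
    for T z :: complex
    unfolding n geometric_sum_odd by (simp add: power_mult_distrib power_mult)
  have pow: "T * (T^m)^2 = T^n" "T * T^(2*m) = T^n" for T :: complex
    by (simp_all add: n power_mult mult.commute[of 2 m] power_mult[of T m 2])
  have core: "al*de - T*(T^m)^2*be*ga = 1 \<and>
     al*(1-T*H^2) - T*(T^m)^2*be*(H*H^(2*m)) = (1-T*K^2)*de + T*(T^m)^2*be*(K*K^(2*m)) \<and>
     al*(H*H^(2*m)) + be*(\<Sum>j<n. (T*H^2)^j) = (1-T*K^2)*ga + K*K^(2*m)*al \<and>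
     ga*(1-T*H^2) - de*(H*H^(2*m)) = (\<Sum>j<n. (T*K^2)^j)*be - K*K^(2*m)*de \<and>
     T*(T^m)^2*ga*(H*H^(2*m)) + de*(\<Sum>j<n. (T*H^2)^j) = (\<Sum>j<n. (T*K^2)^j)*al - T*(T^m)^2*(K*K^(2*m))*ga"
    if "H = poly (c h) T" "K = poly (c k) T" "al = poly \<alpha> T" "be = poly \<beta> T" "ga = poly \<gamma> T" "de = poly \<delta> T"
    for T H K al be ga de
    unfolding geo'
    by (intro conjI; rule change_of_basis_identities[OF geo geo, where k = be])
       (simp_all add: that ck greek pS X_def)
  have det: "\<alpha> * \<delta> - monom 1 n * \<beta> * \<gamma> = 1"
    unfolding poly_eq_poly_eq_iff[symmetric]
    using core by (simp add: fun_eq_iff poly_monom flip: pow(1))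
  have real: "cnj (poly \<alpha> z) = poly \<alpha> (cnj z)" "cnj (poly \<beta> z) = poly \<beta> (cnj z)"
    "cnj (poly \<gamma> z) = poly \<gamma> (cnj z)" "cnj (poly \<delta> z) = poly \<delta> (cnj z)" for z
    by (simp_all add: greek pS X_def c_def cnj_poly_of_real)
  have "fibre_map n \<alpha> \<beta> \<gamma> \<delta> \<circ> mu n h = mu n k \<circ> fibre_map n \<alpha> \<beta> \<gamma> \<delta>"
    by (rule fibre_map_mu[OF real], unfold Let_def)
       (use core[OF refl refl refl refl refl refl, unfolded pow c_def] in blast)
  then show ?thesis using regular_aut_fibre_map[OF det] fibre_map_act by blast
qed

text \<open>The base change leads from \<open>mu n h\<close> to \<open>mu n (rescale r h')\<close>,
  and the dilation by \<open>r\<close> leads on to \<open>mu n h'\<close>.\<close>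

lemma equivalent_mu:
  fixes h h' :: "real poly"
  assumes n: "n = 2*m+1" and r: "r \<noteq> 0" and dvd: "[:0,1:]^m dvd h - rescale r h'"
  shows "equivalent_forms n (mu n h) (mu n h')"
proof -
  from dvd obtain \<kappa> where "h - rescale r h' = monom 1 m * \<kappa>"
    by (auto simp: monom_altdef)
  then have "rescale r h' = h + monom 1 m * (-\<kappa>)" by (simp add: algebra_simps)
  from fibre_equivalence[OF n this] obtain \<psi> where \<psi>: "regular_aut \<psi>"
    "\<And>t p. t \<noteq> 0 \<Longrightarrow> \<psi> (act n t p) = act n t (\<psi> p)" "\<psi> \<circ> mu n h = mu n (rescale r h') \<circ> \<psi>"
    by blast
  show ?thesis
  proof (rule equivalent_formsI)
    show "regular_aut (dilation r \<circ> \<psi>)" by (intro regular_aut_compose regular_aut_dilation r \<psi>)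
    show "(dilation r \<circ> \<psi>) (act n t p) = act n t ((dilation r \<circ> \<psi>) p)" if "t \<noteq> 0" for t p
      using that by (simp add: \<psi> dilation_act)
    have "dilation r \<circ> \<psi> \<circ> mu n h = (dilation r \<circ> mu n (rescale r h')) \<circ> \<psi>"
      using \<psi>(3) by (simp add: comp_assoc)
    then show "dilation r \<circ> \<psi> \<circ> mu n h = mu n h' \<circ> (dilation r \<circ> \<psi>)"
      unfolding dilation_mu by (simp add: comp_assoc)
  qed
qed

subsection \<open>Isometries over the polynomial ring\<close>

lemma degree_eq_0_if_bounded_on_negatives:
  fixes p :: "complex poly"
  assumes "\<And>t::real. t < 0 \<Longrightarrow> norm (poly p (of_real t)) \<le> C"
  shows "degree p = 0"
proof (rule ccontr)
  assume "degree p \<noteq> 0"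
  then obtain a q where p: "p = pCons a q" "q \<noteq> 0"
    by (cases p) (auto split: if_splits)
  obtain r where r: "\<And>z. r \<le> norm z \<Longrightarrow> C + 1 \<le> norm (poly p z)"
    using poly_infinity[OF p(2), of "C + 1" a] p(1) by auto
  have "C + 1 \<le> norm (poly p (of_real (- (\<bar>r\<bar> + 1))))" by (rule r, subst norm_of_real) simp
  moreover have "norm (poly p (of_real (- (\<bar>r\<bar> + 1)))) \<le> C" by (rule assms) simp
  ultimately show False by linarith
qed

text \<open>For t < 0 both summands are nonnegative, so each is bounded by the constant
  \<open>Re c\<close>, and a polynomial bounded on the negative axis is constant.\<close>

lemma constant_if_hermitian_norm_constant:
  fixes U V :: "complex poly"
  assumes eq: "\<And>t::real. t < 0 \<Longrightarrow>
    poly U (of_real t) * cnj (poly U (of_real t)) - of_real t * (poly V (of_real t) * cnj (poly V (of_real t))) = c"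
  shows "\<exists>u. U = [:u:] \<and> V = 0 \<and> u * cnj u = c"
proof -
  have norms: "(norm (poly U (of_real t)))^2 + (- t) * (norm (poly V (of_real t)))^2 = Re c" if "t < 0" for t
    using arg_cong[OF eq[OF that], of Re] by (simp flip: complex_norm_square)
  have "degree U = 0"
  proof (rule degree_eq_0_if_bounded_on_negatives)
    fix t :: real assume t: "t < 0"
    have "0 \<le> (- t) * (norm (poly V (of_real t)))^2" using t by (intro mult_nonneg_nonneg) auto
    then have "(norm (poly U (of_real t)))^2 \<le> Re c" using norms[OF t] by linarith
    then show "norm (poly U (of_real t)) \<le> sqrt (Re c)" by (rule real_le_rsqrt)
  qed
  then obtain u where u: "U = [:u:]" by (rule degree_eq_zeroE)
  \<comment> \<open>The factor T makes this degree odd unless \<open>V = 0\<close>, so boundedness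
    gives vanishing and not merely constancy.\<close>
  have "degree ([:0,1:] * V^2) = 0"
  proof (rule degree_eq_0_if_bounded_on_negatives)
    fix t :: real assume t: "t < 0"
    have "(- t) * (norm (poly V (of_real t)))^2 \<le> Re c"
      using norms[OF t] zero_le_power2[of "norm (poly U (of_real t))"] by linarith
    then show "norm (poly ([:0,1:] * V^2) (of_real t)) \<le> Re c"
      using t by (simp add: norm_mult norm_power)
  qed
  then have V: "V = 0" by (cases "V = 0") (auto simp: degree_mult_eq)
  have "u * cnj u = c" using eq[of "-1"] by (simp add: u V)
  with u V show ?thesis by blast
qed

text \<open>A nonzero coefficient of \<open>h\<close> below degree \<open>m\<close> shows that the
  quotient of \<open>u\<close> and \<open>v\<close> is real; having modulus 1 it is a sign. If there
  is no such coefficient, both polynomials vanish modulo \<open>T^m\<close>.\<close>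

lemma dvd_diff_or_sum:
  fixes h k :: "real poly"
  assumes dvd: "monom 1 m dvd smult u (map_poly complex_of_real h) - smult v (map_poly complex_of_real k)"
    and u: "u \<noteq> 0" and uv: "norm u = norm v"
  shows "monom 1 m dvd h - k \<or> monom 1 m dvd h + k"
proof -
  have eq: "u * of_real (coeff h i) = v * of_real (coeff k i)" if "i < m" for i
    using dvd that by (auto simp: monom_1_dvd_iff' coeff_map_poly)
  have v: "v \<noteq> 0" using u uv by auto
  show ?thesis
  proof (cases "\<exists>i<m. coeff h i \<noteq> 0")
    case True
    then obtain i where i: "i < m" "coeff h i \<noteq> 0" by blast
    have "norm u * \<bar>coeff h i\<bar> = norm v * \<bar>coeff k i\<bar>"
      using arg_cong[OF eq[OF i(1)], of norm] by (simp add: norm_mult)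
    then have "\<bar>coeff h i\<bar> = \<bar>coeff k i\<bar>" using v uv by simp
    then consider "coeff k i = coeff h i" | "coeff k i = - coeff h i" by linarith
    then show ?thesis
    proof cases
      case 1
      then have "u = v" using eq[OF i(1)] i(2) by simp
      then show ?thesis using eq v by (auto simp: monom_1_dvd_iff')
    next
      case 2
      then have "u = - v" using eq[OF i(1)] i(2) by (simp flip: mult_minus_left)
      then have "coeff h j = - coeff k j" if "j < m" for j
        using eq[OF that] v by (simp flip: of_real_minus mult_minus_right)
      then show ?thesis by (auto simp: monom_1_dvd_iff')
    qed
  next
    case False
    then have "coeff k i = 0" if "i < m" for i using eq[OF that] that v by auto
    with False show ?thesis by (auto simp: monom_1_dvd_iff')
  qed
qed

text \<open>Carried over to the standard lattice, the map becomes an isometry of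
  \<open>|X|^2 - T |Y|^2\<close> up to a constant factor. Definiteness at negative T forces it to be
  constant and diagonal, and a constant diagonal map that relates the two lattices relates
  \<open>h\<close> and \<open>k\<close> modulo \<open>T^m\<close>.\<close>

lemma fibre_classification:
  fixes h k :: "real poly" and \<alpha> \<beta> \<gamma> \<delta> :: "complex poly"
  assumes n: "n = 2*m+1" and det: "\<alpha> * \<delta> - monom 1 n * \<beta> * \<gamma> = [:c:]" and c: "c \<noteq> 0"
    and eqs: "\<And>t T H K al be ga de s s'. t < 0 \<Longrightarrow> T = complex_of_real t
     \<Longrightarrow> H = poly (map_poly complex_of_real h) T \<Longrightarrow> K = poly (map_poly complex_of_real k) T
     \<Longrightarrow> al = poly \<alpha> T \<Longrightarrow> be = poly \<beta> T \<Longrightarrow> ga = poly \<gamma> T \<Longrightarrow> de = poly \<delta> T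
     \<Longrightarrow> s = (\<Sum>j<n. (T * H^2)^j) \<Longrightarrow> s' = (\<Sum>j<n. (T * K^2)^j) \<Longrightarrow>
     al*(1-T*H^2) - T^n*be*H^n = (1-T*K^2)*cnj de + T^n*cnj be*K^n \<and>
     al*H^n + be*s = (1-T*K^2)*cnj ga + K^n*cnj al \<and>
     T^n*ga*(1-T*H^2) - T^n*de*H^n = T^n*s'*cnj be - T^n*K^n*cnj de \<and>
     T^n*ga*H^n + de*s = s'*cnj al - T^n*K^n*cnj ga"
  shows "monom 1 m dvd h - k \<or> monom 1 m dvd h + k"
proof -
  define X :: "complex poly" where "X = [:0,1:]"
  define P where "P = X^m"
  define H K where "H = map_poly complex_of_real h" and "K = map_poly complex_of_real k"
  define S S' where "S = (\<Sum>j<m. (X * H^2)^j)" and "S' = (\<Sum>j<m. (X * K^2)^j)"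
  define g g' where "g = H^(2*m)" and "g' = K^(2*m)"
  \<comment> \<open>\<open>(x, y)\<close> is the first row of the matrix times the embedding of the
    H-lattice, and \<open>(X*z, v)\<close> is the second row divided by \<open>P\<close>.\<close>
  define x y z v where "x = \<alpha> + \<beta>*X*P*H*S" and "y = - \<alpha>*H - \<beta>*P*(S+P*g)"
    and "z = P*\<gamma> + \<delta>*H*S" and "v = - X*P*\<gamma>*H - \<delta>*(S+P*g)"
  \<comment> \<open>Removing the embedding of the K-lattice leaves the rows \<open>(U1, V1)\<close>
    and \<open>(X*V2, U2)\<close>. With the factor \<open>X\<close> split off, the condition on the
    second row has the same shape as that on the first.\<close>
  define U1 V1 U2 V2 where "U1 = (S'+P*g')*x - K*X*z" and "V1 = (S'+P*g')*y - K*v"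
    and "U2 = X*K*S'*y - v" and "V2 = K*S'*x - z"
  have geo: "(1 - X * K^2) * S' = 1 - P * g'" "(1 - X * H^2) * S = 1 - P * g"
    unfolding S_def S'_def geometric_sum
    by (simp_all add: P_def g_def g'_def power_mult_distrib power_mult)
  have *: "poly U1 T * cnj (poly U1 T) - T * (poly V1 T * cnj (poly V1 T)) = cnj c \<and>
     poly U2 T * cnj (poly U2 T) - T * (poly V2 T * cnj (poly V2 T)) = cnj c"
    if t: "t < 0" and T: "T = complex_of_real t" for t T
  proof -
    let ?T = T and ?H = "poly H T" and ?K = "poly K T" and ?P = "T^m" and ?S = "poly S T"
      and ?S' = "poly S' T" and ?g = "poly g T" and ?g' = "poly g' T"
    let ?a = "poly \<alpha> T" and ?b = "poly \<beta> T" and ?c = "poly \<gamma> T" and ?d = "poly \<delta> T"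
    have real: "cnj T = T" "cnj ?H = ?H" "cnj ?K = ?K" "cnj ?S = ?S" "cnj ?S' = ?S'" "cnj ?g = ?g" "cnj ?g' = ?g'"
      by (simp_all add: T H_def K_def cnj_poly_of_real S_def S'_def g_def g'_def poly_sum X_def)
    have nz: "T \<noteq> 0" "?P \<noteq> 0" using t T by auto
    have g: "(1 - T*?H^2) * ?S = 1 - ?P*?g" "(1 - T*?K^2) * ?S' = 1 - ?P*?g'"
      using arg_cong[OF geo(2), of "\<lambda>p. poly p T"] arg_cong[OF geo(1), of "\<lambda>p. poly p T"]
      by (simp_all add: X_def P_def)
    have pow: "T^n = T*?P^2" "?H^n = ?H*?g" "?K^n = ?K*?g'"
      by (simp_all add: n g_def g'_def power_mult mult.commute[of 2 m] power_mult[of T m 2])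
    have sums: "(\<Sum>j<n. (T*?H^2)^j) = ?S + ?P*?g*(?S + ?P*?g)" "(\<Sum>j<n. (T*?K^2)^j) = ?S' + ?P*?g'*(?S' + ?P*?g')"
      unfolding n geometric_sum_odd
      by (simp_all add: S_def S'_def g_def g'_def X_def poly_sum power_mult_distrib power_mult)
    note E = eqs[OF t T refl refl refl refl refl refl refl refl, folded H_def K_def, unfolded sums pow]
    have e1: "?a*(1-T*?H^2) - T*?P^2*?b*(?H*?g) = (1-T*?K^2)*cnj ?d + T*?P^2*cnj ?b*(?K*?g')"
      and e2: "?a*(?H*?g) + ?b*(?S+?P*?g*(?S+?P*?g)) = (1-T*?K^2)*cnj ?c + ?K*?g'*cnj ?a"
      and e4: "T*?P^2*?c*(?H*?g) + ?d*(?S+?P*?g*(?S+?P*?g)) = (?S'+?P*?g'*(?S'+?P*?g'))*cnj ?a - T*?P^2*(?K*?g')*cnj ?c"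
      using E by blast+
    \<comment> \<open>The third equation is given only up to the factor \<open>T^n\<close>, which is
      nonzero for t < 0.\<close>
    have "T*?P^2*(?c*(1-T*?H^2) - ?d*(?H*?g)) = T*?P^2*((?S'+?P*?g'*(?S'+?P*?g'))*cnj ?b - ?K*?g'*cnj ?d)"
      using conjunct1[OF conjunct2[OF conjunct2[OF E]]] by (simp only: right_diff_distrib mult.assoc)
    then have e3: "?c*(1-T*?H^2) - ?d*(?H*?g) = (?S'+?P*?g'*(?S'+?P*?g'))*cnj ?b - ?K*?g'*cnj ?d"
      using nz by (metis mult_left_cancel no_zero_divisors power_not_zero)
    have "?a * ?d - T*?P^2 * ?b * ?c = c"
      using arg_cong[OF det, of "\<lambda>p. poly p T"] by (simp add: poly_monom pow)
    from arg_cong[OF this, of cnj] have d: "cnj ?a * cnj ?d - T*?P^2*cnj ?b*cnj ?c = cnj c"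
      by (simp add: real)
    have xyzv: "poly x T = ?a + ?b*T*?P*?H*?S" "poly y T = - ?a*?H - ?b*?P*(?S+?P*?g)"
      "T * poly z T = T*?P*?c + T*?d*?H*?S" "poly v T = - T*?P*?c*?H - ?d*(?S+?P*?g)"
      "cnj (poly x T) = cnj ?a + cnj ?b*T*?P*?H*?S" "cnj (poly y T) = - cnj ?a*?H - cnj ?b*?P*(?S+?P*?g)"
      "T * cnj (poly z T) = T*?P*cnj ?c + T*cnj ?d*?H*?S" "cnj (poly v T) = - T*?P*cnj ?c*?H - cnj ?d*(?S+?P*?g)"
      by (simp_all add: x_def y_def z_def v_def X_def P_def real algebra_simps)
    note norms = gram_matrix_transport[OF g nz e1 e2 e3 e4 d, folded xyzv]
    note N = unimodular_gram_matrix[OF g(2) norms]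
    have 1: "poly U1 T = (?S'+?P*?g')*poly x T - ?K*(T*poly z T)" "poly V1 T = (?S'+?P*?g')*poly y T - ?K*poly v T"
      "poly U2 T = T*?K*?S'*poly y T - poly v T" "T * poly V2 T = T*?K*?S'*poly x T - T * poly z T"
      "cnj (poly U1 T) = (?S'+?P*?g')*cnj (poly x T) - ?K*(T*cnj (poly z T))" "cnj (poly V1 T) = (?S'+?P*?g')*cnj (poly y T) - ?K*cnj (poly v T)"
      "cnj (poly U2 T) = T*?K*?S'*cnj (poly y T) - cnj (poly v T)" "T * cnj (poly V2 T) = T*?K*?S'*cnj (poly x T) - T * cnj (poly z T)"
      by (simp_all add: U1_def V1_def U2_def V2_def X_def P_def real algebra_simps)
    have "poly U1 T * cnj (poly U1 T) - T * (poly V1 T * cnj (poly V1 T)) = cnj c"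
      using N(1) unfolding 1(5-8) unfolding 1(1-4) by simp
    moreover have "(T * poly V2 T) * (T * cnj (poly V2 T)) - T * (poly U2 T * cnj (poly U2 T)) = - T * cnj c"
      using N(2) unfolding 1(5-8) unfolding 1(1-4) by simp
    then have "T * (poly U2 T * cnj (poly U2 T) - T * (poly V2 T * cnj (poly V2 T))) = T * cnj c"
      by (simp add: algebra_simps)
    ultimately show ?thesis using nz by simp
  qed
  obtain e1 where e1: "U1 = [:e1:]" "V1 = 0" "e1 * cnj e1 = cnj c"
    using constant_if_hermitian_norm_constant[of U1 V1 "cnj c"] * by blast
  obtain e2 where e2: "U2 = [:e2:]" "V2 = 0" "e2 * cnj e2 = cnj c"
    using constant_if_hermitian_norm_constant[of U2 V2 "cnj c"] * by blast
  have unit: "(S' + P*g') - X*K^2*S' = 1" using geo(1) by algebra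
  have "x = ((S' + P*g') - X*K^2*S') * x" "y = ((S' + P*g') - X*K^2*S') * y" unfolding unit by simp_all
  \<comment> \<open>Multiplying back by the embedding of the K-lattice recovers the first row from
    the diagonal isometry.\<close>
  then have "x = U1 - X*K*V2" "y = V1 - K*U2" unfolding U1_def V2_def V1_def U2_def by algebra+
  then have xy: "x = [:e1:]" "y = - K*[:e2:]" by (simp_all add: e1 e2)
  \<comment> \<open>Modulo \<open>P\<close> the row \<open>(x, y)\<close> is \<alpha> times
    \<open>(1, -H)\<close>, so this combination vanishes there. Computed from the diagonal isometry
    instead, it is \<open>smult e1 H - smult e2 K\<close>.\<close>
  have "x*H + y = P*(\<beta>*X*H^2*S - \<beta>*(S+P*g))"
    unfolding x_def y_def by algebra
  moreover have "x*H + y = smult e1 H - smult e2 K" by (simp add: xy)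
  ultimately have "P dvd smult e1 H - smult e2 K" by simp
  moreover have "P = monom 1 m" by (simp add: P_def X_def monom_altdef)
  moreover have "(norm e1)^2 = (norm e2)^2"
    using e1(3) e2(3) by (metis complex_norm_square of_real_eq_iff)
  then have "norm e1 = norm e2" by simp
  moreover have "e1 \<noteq> 0" using e1(3) c by auto
  ultimately show ?thesis using dvd_diff_or_sum[of m e1 h e2 k] by (simp add: H_def K_def)
qed

subsection \<open>Linearization along the fixed plane\<close>

lemma continuous_regular: "f \<in> regular_fun \<Longrightarrow> continuous_on UNIV f"
proof (induction rule: regular_fun.induct)
  case coord_a show ?case by (simp add: case_prod_unfold continuous_intros)
next
  case coord_b show ?case by (simp add: case_prod_unfold continuous_intros)
next
  case coord_x show ?case by (simp add: case_prod_unfold continuous_intros)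
next
  case coord_y show ?case by (simp add: case_prod_unfold continuous_intros)
qed (auto intro!: continuous_intros)

lemma continuous_regular_map:
  assumes "regular_map \<psi>" shows "continuous_on UNIV \<psi>"
proof -
  have "continuous_on UNIV (\<lambda>p. (fst (\<psi> p), fst (snd (\<psi> p)), fst (snd (snd (\<psi> p))), snd (snd (snd (\<psi> p)))))"
    using assms unfolding regular_map_def by (intro continuous_on_Pair continuous_regular) auto
  then show ?thesis by simp
qed

text \<open>On x = y = 0 the functions \<open>G\<close> and \<open>H\<close> are the partial
  derivatives of \<open>f\<close> in x and y. With them normal derivatives are handled by division
  and continuity alone.\<close>

lemma regular_split:
  assumes "f \<in> regular_fun"
  shows "\<exists>G\<in>regular_fun. \<exists>H\<in>regular_fun. \<forall>a b x y. f (a,b,x,y) = f (a,b,0,0) + x * G (a,b,x,y) + y * H (a,b,x,y)"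
  using assms
proof induction
  case (add f g)
  then obtain G H G' H' where R: "G \<in> regular_fun" "H \<in> regular_fun" "G' \<in> regular_fun" "H' \<in> regular_fun"
    and e: "\<And>a b x y. f (a,b,x,y) = f (a,b,0,0) + x * G (a,b,x,y) + y * H (a,b,x,y)"
      "\<And>a b x y. g (a,b,x,y) = g (a,b,0,0) + x * G' (a,b,x,y) + y * H' (a,b,x,y)" by metis
  show ?case
  proof (intro bexI allI)
    fix a b x y
    show "f (a,b,x,y) + g (a,b,x,y) = f (a,b,0,0) + g (a,b,0,0) + x * (G (a,b,x,y) + G' (a,b,x,y)) + y * (H (a,b,x,y) + H' (a,b,x,y))"
      using e[of a b x y] by algebra
  qed (auto intro!: regular_fun.add R)
next
  case (mult f g)
  then obtain G H G' H' where R: "G \<in> regular_fun" "H \<in> regular_fun" "G' \<in> regular_fun" "H' \<in> regular_fun"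
    and e: "\<And>a b x y. f (a,b,x,y) = f (a,b,0,0) + x * G (a,b,x,y) + y * H (a,b,x,y)"
      "\<And>a b x y. g (a,b,x,y) = g (a,b,0,0) + x * G' (a,b,x,y) + y * H' (a,b,x,y)" by metis
  have "regular_map (\<lambda>p. (fst p, fst (snd p), 0, 0))"
    unfolding regular_map_def by (auto intro!: regular_intros)
  from regular_fun_compose[OF \<open>f \<in> regular_fun\<close> this]
  have f0: "(\<lambda>p. f (fst p, fst (snd p), 0, 0)) \<in> regular_fun" .
  show ?case
  proof (intro bexI allI)
    fix a b x y
    show "f (a,b,x,y) * g (a,b,x,y) = f (a,b,0,0) * g (a,b,0,0)
      + x * (\<lambda>p. G p * g p + f (fst p, fst (snd p), 0, 0) * G' p) (a,b,x,y)
      + y * (\<lambda>p. H p * g p + f (fst p, fst (snd p), 0, 0) * H' p) (a,b,x,y)"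
      unfolding fst_conv snd_conv using e[of a b x y] by algebra
  qed (auto intro!: regular_fun.add regular_fun.mult R f0 mult.hyps)
next
  case (const c) show ?case
    by (intro bexI[of _ "\<lambda>p. 0"]) (auto intro: regular_fun.const)
next
  case coord_a show ?case
    by (intro bexI[of _ "\<lambda>p. 0"]) (auto intro: regular_fun.const)
next
  case coord_b show ?case
    by (intro bexI[of _ "\<lambda>p. 0"]) (auto intro: regular_fun.const)
next
  case coord_x show ?case
    by (rule bexI[of _ "\<lambda>p. 1"], rule bexI[of _ "\<lambda>p. 0"]) (auto intro: regular_fun.const)
next
  case coord_y show ?case
    by (rule bexI[of _ "\<lambda>p. 0"], rule bexI[of _ "\<lambda>p. 1"]) (auto intro: regular_fun.const)
qed

lemma regular_on_curve:
  assumes "f \<in> regular_fun"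
  shows "\<exists>P. \<forall>T. f (poly A T, poly B T, 0, 0) = poly P T"
  using assms
proof induction
  case (const c) show ?case by (rule exI[of _ "[:c:]"]) simp
next
  case (add f g)
  then show ?case by (metis poly_add)
next
  case (mult f g)
  then show ?case by (metis poly_mult)
qed (auto intro: exI[of _ A] exI[of _ B] exI[of _ 0])

text \<open>This serves to cancel a common factor \<open>s\<close> from an identity and still
  evaluate at s = 0, which amounts to differentiating along a line.\<close>

lemma equal_at_0:
  fixes F G :: "complex \<Rightarrow> complex"
  assumes "continuous_on UNIV F" "continuous_on UNIV G" "\<And>s. s \<noteq> 0 \<Longrightarrow> F s = G s"
  shows "F 0 = G 0"
proof (rule tendsto_unique)
  show "(F \<longlongrightarrow> F 0) (at 0)" using assms(1) by (simp add: continuous_on_def)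
  have "(G \<longlongrightarrow> G 0) (at 0)" using assms(2) by (simp add: continuous_on_def)
  then show "(F \<longlongrightarrow> G 0) (at 0)"
    by (rule Lim_transform_eventually) (auto simp: eventually_at_filter assms(3))
qed simp

text \<open>For nonzero \<open>a\<close> some \<open>t\<close> with \<open>t^2 = inverse a\<close>
  moves \<open>(a, b)\<close> to \<open>(1, a*b)\<close>, so the restriction of \<open>f\<close> to
  the slice a = 1 determines it. Continuity covers a = 0.\<close>

lemma positive_weight:
  assumes f: "f \<in> regular_fun"
    and w: "\<And>t a b. t \<noteq> 0 \<Longrightarrow> f (t\<^sup>2 * a, (inverse t)\<^sup>2 * b, 0, 0) = t^(2*k) * f (a,b,0,0)"
  shows "\<exists>P. \<forall>a b. f (a,b,0,0) = a^k * poly P (a*b)"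
proof -
  obtain P where P: "\<And>T. f (1,T,0,0) = poly P T"
    using regular_on_curve[OF f, of 1 "[:0,1:]"] by auto
  have nz: "f (a,b,0,0) = a^k * poly P (a*b)" if a: "a \<noteq> 0" for a b
  proof -
    define t where "t = inverse (csqrt a)"
    have t: "t \<noteq> 0" "t\<^sup>2 = inverse a" "(inverse t)\<^sup>2 = a" using a by (auto simp: t_def power_inverse)
    show ?thesis using w[OF t(1), of a b] a unfolding power_mult t by (simp add: P field_simps)
  qed
  have "f (0,b,0,0) = 0^k * poly P (0*b)" for b
    by (rule equal_at_0[of "\<lambda>s. f (s,b,0,0)" "\<lambda>s. s^k * poly P (s*b)"])
       (use nz in \<open>auto intro!: continuous_intros continuous_on_compose2[OF continuous_regular[OF f]]\<close>)
  with nz show ?thesis by metis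
qed

lemma negative_weight:
  assumes f: "f \<in> regular_fun"
    and w: "\<And>t a b. t \<noteq> 0 \<Longrightarrow> f (t\<^sup>2 * a, (inverse t)\<^sup>2 * b, 0, 0) = inverse t^(2*k) * f (a,b,0,0)"
  shows "\<exists>P. \<forall>a b. f (a,b,0,0) = b^k * poly P (a*b)"
proof -
  obtain P where P: "\<And>T. f (T,1,0,0) = poly P T"
    using regular_on_curve[OF f, of "[:0,1:]" 1] by auto
  have nz: "f (a,b,0,0) = b^k * poly P (a*b)" if b: "b \<noteq> 0" for a b
  proof -
    define t where "t = csqrt b"
    have t: "t \<noteq> 0" "t\<^sup>2 = b" "(inverse t)\<^sup>2 = inverse b" using b by (auto simp: t_def power_inverse)
    show ?thesis using w[OF t(1), of a b] b unfolding power_mult t by (simp add: P field_simps)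
  qed
  have "f (a,0,0,0) = 0^k * poly P (a*0)" for a
    by (rule equal_at_0[of "\<lambda>s. f (a,s,0,0)" "\<lambda>s. s^k * poly P (a*s)"])
       (use nz in \<open>auto intro!: continuous_intros continuous_on_compose2[OF continuous_regular[OF f]]\<close>)
  with nz show ?thesis by metis
qed

text \<open>The fixed locus of t = -1 is the plane x = y = 0, and the matrix (G_x, H_x; G_y, H_y)
  restricted to it is the derivative of \<open>\<psi>\<close> in the directions normal to it.\<close>

definition linearization :: "nat \<Rightarrow> (pt \<Rightarrow> pt) \<Rightarrow> complex poly \<Rightarrow> complex poly \<Rightarrow> complex poly \<Rightarrow>
    complex poly \<Rightarrow> complex poly \<Rightarrow> complex poly \<Rightarrow> (pt \<Rightarrow> complex) \<Rightarrow> (pt \<Rightarrow> complex) \<Rightarrow>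
    (pt \<Rightarrow> complex) \<Rightarrow> (pt \<Rightarrow> complex) \<Rightarrow> bool" where
  "linearization n \<psi> f g \<alpha> \<beta> \<gamma> \<delta> Gx Hx Gy Hy \<longleftrightarrow>
    continuous_on UNIV \<psi> \<and> continuous_on UNIV Gx \<and> continuous_on UNIV Hx \<and>
    continuous_on UNIV Gy \<and> continuous_on UNIV Hy \<and>
    (\<forall>a b. \<psi> (a,b,0,0) = (a * poly f (a*b), b * poly g (a*b), 0, 0) \<and>
      Gx (a,b,0,0) = poly \<alpha> (a*b) \<and> Hx (a,b,0,0) = a^n * poly \<beta> (a*b) \<and>
      Gy (a,b,0,0) = b^n * poly \<gamma> (a*b) \<and> Hy (a,b,0,0) = poly \<delta> (a*b)) \<and>
    (\<forall>a b x y. snd (snd (\<psi> (a,b,x,y)))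
      = (x * Gx (a,b,x,y) + y * Hx (a,b,x,y), x * Gy (a,b,x,y) + y * Hy (a,b,x,y)))"

lemma linearization_exists:
  assumes \<psi>: "regular_map \<psi>" and act: "\<And>t p. t \<noteq> 0 \<Longrightarrow> \<psi> (act n t p) = act n t (\<psi> p)" and n: "odd n"
  shows "\<exists>f g \<alpha> \<beta> \<gamma> \<delta> Gx Hx Gy Hy. linearization n \<psi> f g \<alpha> \<beta> \<gamma> \<delta> Gx Hx Gy Hy"
proof -
  define A B X Y where "A = (\<lambda>p. fst (\<psi> p))" "B = (\<lambda>p. fst (snd (\<psi> p)))"
    "X = (\<lambda>p. fst (snd (snd (\<psi> p))))" "Y = (\<lambda>p. snd (snd (snd (\<psi> p))))"
  note comps = this
  have reg: "A \<in> regular_fun" "B \<in> regular_fun" "X \<in> regular_fun" "Y \<in> regular_fun"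
    using \<psi> by (auto simp: regular_map_def comps)
  have \<psi>_eq: "\<psi> p = (A p, B p, X p, Y p)" for p by (simp add: comps)
  have w: "A (t\<^sup>2*a, (inverse t)\<^sup>2*b, t^n*x, inverse t^n*y) = t\<^sup>2 * A (a,b,x,y)"
    "B (t\<^sup>2*a, (inverse t)\<^sup>2*b, t^n*x, inverse t^n*y) = (inverse t)\<^sup>2 * B (a,b,x,y)"
    "X (t\<^sup>2*a, (inverse t)\<^sup>2*b, t^n*x, inverse t^n*y) = t^n * X (a,b,x,y)"
    "Y (t\<^sup>2*a, (inverse t)\<^sup>2*b, t^n*x, inverse t^n*y) = inverse t^n * Y (a,b,x,y)"
    if "t \<noteq> 0" for t a b x y
    using act[OF that, of "(a,b,x,y)"] by (simp_all add: act_def \<psi>_eq)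
  obtain f where f: "\<And>a b. A (a,b,0,0) = a * poly f (a*b)"
    using positive_weight[OF reg(1), of 1] w(1)[of _ _ _ 0 0] by auto
  obtain g where g: "\<And>a b. B (a,b,0,0) = b * poly g (a*b)"
    using negative_weight[OF reg(2), of 1] w(2)[of _ _ _ 0 0] by auto
  \<comment> \<open>For t = -1 the action fixes these points and, \<open>n\<close> being odd,
    negates the last two coordinates of their images.\<close>
  have XY0: "X (a,b,0,0) = 0" "Y (a,b,0,0) = 0" for a b
    using w(3,4)[of "-1" a b 0 0] n by simp_all
  obtain Gx Hx where G: "Gx \<in> regular_fun" "Hx \<in> regular_fun"
    and X: "\<And>a b x y. X (a,b,x,y) = x * Gx (a,b,x,y) + y * Hx (a,b,x,y)"
    using regular_split[OF reg(3)] by (auto simp: XY0)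
  obtain Gy Hy where H: "Gy \<in> regular_fun" "Hy \<in> regular_fun"
    and Y: "\<And>a b x y. Y (a,b,x,y) = x * Gy (a,b,x,y) + y * Hy (a,b,x,y)"
    using regular_split[OF reg(4)] by (auto simp: XY0)
  note cont = continuous_on_compose2[OF continuous_regular[OF G(1)]] continuous_on_compose2[OF continuous_regular[OF G(2)]]
    continuous_on_compose2[OF continuous_regular[OF H(1)]] continuous_on_compose2[OF continuous_regular[OF H(2)]]
  \<comment> \<open>The weight of each normal derivative is the weight of the target coordinate
    minus that of the source: 0 on the diagonal, 2n for \<open>Hx\<close> and -2n for
    \<open>Gy\<close>.\<close>
  have wGx: "Gx (t\<^sup>2*a, (inverse t)\<^sup>2*b, 0, 0) = t^(2*0) * Gx (a,b,0,0)" if t: "t \<noteq> 0" for t a b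
  proof -
    have "Gx (t\<^sup>2*a, (inverse t)\<^sup>2*b, t^n*0, 0) = Gx (a,b,0,0)"
      by (rule equal_at_0[of "\<lambda>s. Gx (t\<^sup>2*a, (inverse t)\<^sup>2*b, t^n*s, 0)" "\<lambda>s. Gx (a,b,s,0)"]) (use w(3)[OF t, of a b _ 0] t in
        \<open>auto intro!: continuous_intros cont simp: X\<close>)
    then show ?thesis by simp
  qed
  have wHy: "Hy (t\<^sup>2*a, (inverse t)\<^sup>2*b, 0, 0) = t^(2*0) * Hy (a,b,0,0)" if t: "t \<noteq> 0" for t a b
  proof -
    have "Hy (t\<^sup>2*a, (inverse t)\<^sup>2*b, 0, inverse t^n*0) = Hy (a,b,0,0)"
      by (rule equal_at_0[of "\<lambda>s. Hy (t\<^sup>2*a, (inverse t)\<^sup>2*b, 0, inverse t^n*s)" "\<lambda>s. Hy (a,b,0,s)"]) (use w(4)[OF t, of a b 0] t in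
        \<open>auto intro!: continuous_intros cont simp: Y\<close>)
    then show ?thesis by simp
  qed
  have wHx: "Hx (t\<^sup>2*a, (inverse t)\<^sup>2*b, 0, 0) = t^(2*n) * Hx (a,b,0,0)" if t: "t \<noteq> 0" for t a b
  proof -
    have "Hx (t\<^sup>2*a, (inverse t)\<^sup>2*b, 0, inverse t^n*0) = t^(2*n) * Hx (a,b,0,0)"
      by (rule equal_at_0[of "\<lambda>s. Hx (t\<^sup>2*a, (inverse t)\<^sup>2*b, 0, inverse t^n*s)" "\<lambda>s. t^(2*n) * Hx (a,b,0,s)"]) (use w(3)[OF t, of a b 0] t in
        \<open>auto intro!: continuous_intros cont simp: X field_simps mult_2_right power_add\<close>)
    then show ?thesis by simp
  qed
  have wGy: "Gy (t\<^sup>2*a, (inverse t)\<^sup>2*b, 0, 0) = inverse t^(2*n) * Gy (a,b,0,0)" if t: "t \<noteq> 0" for t a b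
  proof -
    have "Gy (t\<^sup>2*a, (inverse t)\<^sup>2*b, t^n*0, 0) = inverse t^(2*n) * Gy (a,b,0,0)"
      by (rule equal_at_0[of "\<lambda>s. Gy (t\<^sup>2*a, (inverse t)\<^sup>2*b, t^n*s, 0)" "\<lambda>s. inverse t^(2*n) * Gy (a,b,s,0)"]) (use w(4)[OF t, of a b _ 0] t in
        \<open>auto intro!: continuous_intros cont simp: Y field_simps mult_2_right power_add\<close>)
    then show ?thesis by simp
  qed
  obtain \<alpha> where \<alpha>: "\<And>a b. Gx (a,b,0,0) = poly \<alpha> (a*b)" using positive_weight[OF G(1) wGx] by auto
  obtain \<beta> where \<beta>: "\<And>a b. Hx (a,b,0,0) = a^n * poly \<beta> (a*b)" using positive_weight[OF G(2) wHx] by auto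
  obtain \<gamma> where \<gamma>: "\<And>a b. Gy (a,b,0,0) = b^n * poly \<gamma> (a*b)" using negative_weight[OF H(1) wGy] by auto
  obtain \<delta> where \<delta>: "\<And>a b. Hy (a,b,0,0) = poly \<delta> (a*b)" using positive_weight[OF H(2) wHy] by auto
  have "linearization n \<psi> f g \<alpha> \<beta> \<gamma> \<delta> Gx Hx Gy Hy"
    unfolding linearization_def using G H continuous_regular continuous_regular_map[OF \<psi>]
    by (simp add: \<psi>_eq f g XY0 X Y \<alpha> \<beta> \<gamma> \<delta>)
  then show ?thesis by blast
qed

lemma linearizationD:
  assumes "linearization n \<psi> f g \<alpha> \<beta> \<gamma> \<delta> Gx Hx Gy Hy"
  shows "continuous_on UNIV \<psi>" "continuous_on UNIV Gx" "continuous_on UNIV Hx"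
    "continuous_on UNIV Gy" "continuous_on UNIV Hy"
    "\<psi> (a,b,0,0) = (a * poly f (a*b), b * poly g (a*b), 0, 0)"
    "Gx (a,b,0,0) = poly \<alpha> (a*b)" "Hx (a,b,0,0) = a^n * poly \<beta> (a*b)"
    "Gy (a,b,0,0) = b^n * poly \<gamma> (a*b)" "Hy (a,b,0,0) = poly \<delta> (a*b)"
    "\<psi> (a,b,x,y) = (fst (\<psi> (a,b,x,y)), fst (snd (\<psi> (a,b,x,y))),
       x * Gx (a,b,x,y) + y * Hx (a,b,x,y), x * Gy (a,b,x,y) + y * Hy (a,b,x,y))"
  using assms by (simp_all add: linearization_def prod_eq_iff)

text \<open>At a point of the plane the chain rule makes the normal derivatives of \<psi> and of its
  left inverse inverse to each other. Every T is reached by the point \<open>(1, T)\<close>.\<close>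

lemma linearization_invertible:
  assumes L: "linearization n \<psi> f g \<alpha> \<beta> \<gamma> \<delta> Gx Hx Gy Hy"
    and M: "linearization n \<phi> f' g' \<alpha>' \<beta>' \<gamma>' \<delta>' Gx' Hx' Gy' Hy'"
    and inv: "\<And>p. \<phi> (\<psi> p) = p"
  shows "poly f T \<noteq> 0" "poly g T \<noteq> 0" "poly (\<alpha> * \<delta> - monom 1 n * \<beta> * \<gamma>) T \<noteq> 0"
proof -
  show "poly f T \<noteq> 0"
    using inv[of "(1,T,0,0)"] by (auto simp: linearizationD(6)[OF L] linearizationD(6)[OF M])
  show "poly g T \<noteq> 0"
    using inv[of "(T,1,0,0)"] by (auto simp: linearizationD(6)[OF L] linearizationD(6)[OF M])
  note cont = continuous_on_compose2[OF linearizationD(1)[OF L]]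
    continuous_on_compose2[OF linearizationD(2)[OF L]] continuous_on_compose2[OF linearizationD(3)[OF L]]
    continuous_on_compose2[OF linearizationD(4)[OF L]] continuous_on_compose2[OF linearizationD(5)[OF L]]
    continuous_on_compose2[OF linearizationD(2)[OF M]] continuous_on_compose2[OF linearizationD(3)[OF M]]
    continuous_on_compose2[OF linearizationD(4)[OF M]] continuous_on_compose2[OF linearizationD(5)[OF M]]
  \<comment> \<open>A line through \<open>(1, T, 0, 0)\<close> in the normal direction
    \<open>(v, w)\<close>.\<close>
  define q where "q v w s = (1::complex, T, s * v, s * w)" for v w s :: complex
  have q0: "q v w 0 = (1,T,0,0)" for v w by (simp add: q_def)
  have cq: "continuous_on UNIV (q v w)" for v w unfolding q_def by (intro continuous_intros)
  define X Y where "X v w s = v * Gx (q v w s) + w * Hx (q v w s)"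
    and "Y v w s = v * Gy (q v w s) + w * Hy (q v w s)" for v w s
  have comp: "s * (X v w s * Gx' (\<psi> (q v w s)) + Y v w s * Hx' (\<psi> (q v w s))) = s * v"
    "s * (X v w s * Gy' (\<psi> (q v w s)) + Y v w s * Hy' (\<psi> (q v w s))) = s * w" for v w s
  proof -
    obtain a b where \<psi>q: "\<psi> (q v w s) = (a, b, s * X v w s, s * Y v w s)"
      using linearizationD(11)[OF L, of 1 T "s*v" "s*w"] by (auto simp: q_def X_def Y_def algebra_simps)
    have "\<phi> (\<psi> (q v w s)) = q v w s" by (rule inv)
    then show "s * (X v w s * Gx' (\<psi> (q v w s)) + Y v w s * Hx' (\<psi> (q v w s))) = s * v"
      "s * (X v w s * Gy' (\<psi> (q v w s)) + Y v w s * Hy' (\<psi> (q v w s))) = s * w"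
      using linearizationD(11)[OF M, of a b "s * X v w s" "s * Y v w s"]
      unfolding \<psi>q by (auto simp: q_def algebra_simps)
  qed
  have at0: "X v w 0 * Gx' (\<psi> (1,T,0,0)) + Y v w 0 * Hx' (\<psi> (1,T,0,0)) = v"
    "X v w 0 * Gy' (\<psi> (1,T,0,0)) + Y v w 0 * Hy' (\<psi> (1,T,0,0)) = w" for v w
  proof -
    have "X v w 0 * Gx' (\<psi> (q v w 0)) + Y v w 0 * Hx' (\<psi> (q v w 0)) = v"
      by (rule equal_at_0[of "\<lambda>s. X v w s * Gx' (\<psi> (q v w s)) + Y v w s * Hx' (\<psi> (q v w s))" "\<lambda>s. v"])
         (use comp(1) in \<open>auto simp: X_def Y_def intro!: continuous_intros cont cq\<close>)
    moreover have "X v w 0 * Gy' (\<psi> (q v w 0)) + Y v w 0 * Hy' (\<psi> (q v w 0)) = w"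
      by (rule equal_at_0[of "\<lambda>s. X v w s * Gy' (\<psi> (q v w s)) + Y v w s * Hy' (\<psi> (q v w s))" "\<lambda>s. w"])
         (use comp(2) in \<open>auto simp: X_def Y_def intro!: continuous_intros cont cq\<close>)
    ultimately show "X v w 0 * Gx' (\<psi> (1,T,0,0)) + Y v w 0 * Hx' (\<psi> (1,T,0,0)) = v"
      "X v w 0 * Gy' (\<psi> (1,T,0,0)) + Y v w 0 * Hy' (\<psi> (1,T,0,0)) = w" by (simp_all add: q0)
  qed
  define al be ga de where "al = Gx (1,T,0,0)" "be = Hx (1,T,0,0)" "ga = Gy (1,T,0,0)" "de = Hy (1,T,0,0)"
  note vals = this
  obtain p q r t where pqrt: "p = Gx' (\<psi> (1,T,0,0))" "q = Hx' (\<psi> (1,T,0,0))"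
    "r = Gy' (\<psi> (1,T,0,0))" "t = Hy' (\<psi> (1,T,0,0))" by blast
  \<comment> \<open>The two coordinate directions give the four entries of a matrix product equal to
    the identity; its determinant is the product of the two determinants.\<close>
  have "al * p + ga * q = 1" "be * p + de * q = 0" "al * r + ga * t = 0" "be * r + de * t = 1"
    using at0(1)[of 1 0] at0(1)[of 0 1] at0(2)[of 1 0] at0(2)[of 0 1]
    by (simp_all add: X_def Y_def q0 vals pqrt)
  then have "(al * de - be * ga) * (p * t - q * r) = 1" by algebra
  then have "al * de - be * ga \<noteq> 0" by auto
  then show "poly (\<alpha> * \<delta> - monom 1 n * \<beta> * \<gamma>) T \<noteq> 0"
    by (simp add: vals linearizationD[OF L] poly_monom mult_ac)
qed

section \<open>Necessity of the congruence\<close>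

lemma constant_if_no_roots:
  fixes p :: "complex poly"
  assumes "\<And>z. poly p z \<noteq> 0"
  obtains c where "p = [:c:]" "c \<noteq> 0"
proof -
  have "degree p = 0"
    using fundamental_theorem_of_algebra[of p] assms by (auto simp: constant_degree)
  then obtain c where "p = [:c:]" by (rule degree_eq_zeroE)
  with assms[of 0] that show ?thesis by auto
qed

text \<open>These are the entries of the normal derivative of the intertwining relation at
  \<open>(1, T)\<close> with T real. The map \<open>mu0\<close>, then \<psi>, then
  \<open>mu0\<close> sends this point to \<open>(l, T * cnj l)\<close>, which explains
  \<open>T'\<close> and the powers of \<open>l*K\<close> and \<open>cnj l*K\<close>. The factor
  \<open>T^n\<close> in the third equation is \<open>b^n\<close> at \<open>b = T\<close>.\<close>

lemma linearized_relation:
  assumes L: "linearization n \<psi> [:l:] [:l':] \<alpha> \<beta> \<gamma> \<delta> Gx Hx Gy Hy"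
    and com: "\<And>p. \<psi> (mu n h p) = mu n h' (\<psi> p)"
  shows "l' = cnj l"
    and "T = complex_of_real t \<Longrightarrow> H = poly (map_poly complex_of_real h) T \<Longrightarrow> T' = T * (l * cnj l)
     \<Longrightarrow> K = poly (map_poly complex_of_real h') T'
     \<Longrightarrow> al = poly \<alpha> T \<Longrightarrow> be = poly \<beta> T \<Longrightarrow> ga = poly \<gamma> T \<Longrightarrow> de = poly \<delta> T
     \<Longrightarrow> s = (\<Sum>j<n. (T * H^2)^j) \<Longrightarrow> s' = (\<Sum>j<n. (T' * K^2)^j) \<Longrightarrow>
     al*(1-T*H^2) - T^n*be*H^n = (1-T'*K^2)*cnj de + T^n*cnj be*(l*K)^n \<and>
     al*H^n + be*s = (1-T'*K^2)*cnj ga + (l*K)^n*cnj al \<and>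
     T^n*ga*(1-T*H^2) - T^n*de*H^n = T^n*s'*cnj be - T^n*(cnj l*K)^n*cnj de \<and>
     T^n*ga*H^n + de*s = s'*cnj al - T^n*(cnj l*K)^n*cnj ga"
proof -
  \<comment> \<open>Substituting \<open>mu0 q\<close> makes both sides holomorphic in
    \<open>q\<close>.\<close>
  have com': "\<psi> (phi n h q) = phi n h' (mu0 (\<psi> (mu0 q)))" for q
    using com[of "mu0 q"] by (cases q) (simp add: mu_def mu0_def)
  show l': "l' = cnj l"
    using arg_cong[OF com'[of "(1,1,0,0)"], of "\<lambda>p. fst (snd p)"]
    by (simp add: phi_def mu0_def linearizationD(6)[OF L] Let_def)
  assume T: "T = complex_of_real t" and H: "H = poly (map_poly complex_of_real h) T"
    and T': "T' = T * (l * cnj l)" and K: "K = poly (map_poly complex_of_real h') T'"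
    and vals: "al = poly \<alpha> T" "be = poly \<beta> T" "ga = poly \<gamma> T" "de = poly \<delta> T"
    and s: "s = (\<Sum>j<n. (T * H^2)^j)" and s': "s' = (\<Sum>j<n. (T' * K^2)^j)"
  note cont = continuous_on_compose2[OF linearizationD(1)[OF L]]
    continuous_on_compose2[OF linearizationD(2)[OF L]] continuous_on_compose2[OF linearizationD(3)[OF L]]
    continuous_on_compose2[OF linearizationD(4)[OF L]] continuous_on_compose2[OF linearizationD(5)[OF L]]
  have cT: "cnj T = T" by (simp add: T)
  have lim: "al * ((1-T*H^2)*v + H^n*w) + be * (s*w - T^n*H^n*v)
      = (1-T'*K^2) * (w*cnj ga + v*cnj de) + (l*K)^n * (w*cnj al + v*(T^n*cnj be)) \<and>
     T^n*ga * ((1-T*H^2)*v + H^n*w) + de * (s*w - T^n*H^n*v)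
      = s' * (w*cnj al + v*(T^n*cnj be)) - (T*cnj l)^n*K^n * (w*cnj ga + v*cnj de)" for v w
  proof -
    define x y where "x = (1-T*H^2)*v + H^n*w" and "y = s*w - T^n*H^n*v"
    \<comment> \<open>\<open>q z\<close> and \<open>q' z\<close> are the images of
      \<open>(1, T, z*v, z*w)\<close> under \<open>phi n h\<close> and \<open>mu0\<close>.\<close>
    define q where "q z = (1::complex, T, z * x, z * y)" for z
    define q' where "q' z = (T, 1::complex, cnj z * cnj w, cnj z * cnj v)" for z
    have q0: "q 0 = (1,T,0,0)" "q' 0 = (T,1,0,0)" by (simp_all add: q_def q'_def)
    have cq: "continuous_on UNIV q" "continuous_on UNIV q'"
      unfolding q_def q'_def by (intro continuous_intros)+
    define a b where "a z = cnj (fst (snd (\<psi> (q' z))))" and "b z = cnj (fst (\<psi> (q' z)))" for z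
    define k where "k z = poly (map_poly complex_of_real h') (a z * b z)" for z
    define S where "S z = (\<Sum>j<n. (a z * b z * (k z)^2)^j)" for z
    define X Y where "X z = w * cnj (Gy (q' z)) + v * cnj (Hy (q' z))"
      and "Y z = w * cnj (Gx (q' z)) + v * cnj (Hx (q' z))" for z
    have c: "continuous_on UNIV a" "continuous_on UNIV b" "continuous_on UNIV k" "continuous_on UNIV S"
      "continuous_on UNIV X" "continuous_on UNIV Y"
      unfolding a_def b_def k_def S_def X_def Y_def by (auto intro!: continuous_intros cont cq)
    have phi1: "phi n h (1, T, z * v, z * w) = q z" for z
      by (simp add: phi_def q_def x_def y_def H s Let_def algebra_simps)
    have phi2: "mu0 (\<psi> (mu0 (1, T, z * v, z * w))) = (a z, b z, z * X z, z * Y z)" for z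
      using linearizationD(11)[OF L, of T 1 "cnj z * cnj w" "cnj z * cnj v"]
      by (cases "\<psi> (q' z)") (simp add: mu0_def cT a_def b_def X_def Y_def q'_def algebra_simps)
    have eq: "z * (x * Gx (q z) + y * Hx (q z)) = z * ((1 - a z * b z * (k z)^2) * X z + (a z)^n * (k z)^n * Y z)"
      "z * (x * Gy (q z) + y * Hy (q z)) = z * (S z * Y z - (b z)^n * (k z)^n * X z)"
      for z
      using com'[of "(1, T, z*v, z*w)"] linearizationD(11)[OF L, of 1 T "z*x" "z*y"]
      unfolding phi1 phi2 by (auto simp: phi_def q_def k_def S_def Let_def algebra_simps)
    have "x * Gx (q 0) + y * Hx (q 0) = (1 - a 0 * b 0 * (k 0)^2) * X 0 + (a 0)^n * (k 0)^n * Y 0"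
      by (rule equal_at_0[of "\<lambda>z. x * Gx (q z) + y * Hx (q z)"
            "\<lambda>z. (1 - a z * b z * (k z)^2) * X z + (a z)^n * (k z)^n * Y z"])
         (use eq(1) in \<open>auto intro!: continuous_intros cont cq c\<close>)
    moreover have "x * Gy (q 0) + y * Hy (q 0) = S 0 * Y 0 - (b 0)^n * (k 0)^n * X 0"
      by (rule equal_at_0[of "\<lambda>z. x * Gy (q z) + y * Hy (q z)"
            "\<lambda>z. S z * Y z - (b z)^n * (k z)^n * X z"])
         (use eq(2) in \<open>auto intro!: continuous_intros cont cq c\<close>)
    moreover have "a 0 = l" "b 0 = T * cnj l"
      by (simp_all add: a_def b_def q0 linearizationD(6)[OF L] l' cT)
    moreover from this have "k 0 = K" "a 0 * b 0 = T'" by (simp_all add: k_def K T' mult_ac)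
    moreover from this have "S 0 = s'" by (simp add: S_def s')
    ultimately show ?thesis
      by (simp add: q0 X_def Y_def linearizationD(7-10)[OF L] cT x_def y_def power_mult_distrib flip: vals)
         (simp add: algebra_simps)
  qed
  show "al*(1-T*H^2) - T^n*be*H^n = (1-T'*K^2)*cnj de + T^n*cnj be*(l*K)^n \<and>
     al*H^n + be*s = (1-T'*K^2)*cnj ga + (l*K)^n*cnj al \<and>
     T^n*ga*(1-T*H^2) - T^n*de*H^n = T^n*s'*cnj be - T^n*(cnj l*K)^n*cnj de \<and>
     T^n*ga*H^n + de*s = s'*cnj al - T^n*(cnj l*K)^n*cnj ga"
    using lim[of 1 0] lim[of 0 1] by (simp add: power_mult_distrib mult_ac)
qed

lemma equivalent_mu_necessary:
  fixes h h' :: "real poly"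
  assumes n: "n = 2*m+1" and equiv: "equivalent_forms n (mu n h) (mu n h')"
  shows "\<exists>r. r \<noteq> 0 \<and> [:0,1:]^m dvd h - rescale r h'"
proof -
  have odd: "odd n" by (simp add: n)
  obtain \<psi> where aut: "regular_aut \<psi>" and act: "\<And>t p. t \<noteq> 0 \<Longrightarrow> \<psi> (act n t p) = act n t (\<psi> p)"
    and eq: "mu n h' = \<psi> \<circ> mu n h \<circ> inv \<psi>"
    using equiv by (auto simp: equivalent_forms_def)
  have bij: "bij \<psi>" and reg: "regular_map \<psi>" "regular_map (inv \<psi>)"
    using aut by (auto simp: regular_aut_def)
  have inv1: "inv \<psi> (\<psi> p) = p" and inv2: "\<psi> (inv \<psi> p) = p" for p
    using bij by (simp_all add: bij_is_inj bij_is_surj surj_f_inv_f)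
  have act': "inv \<psi> (act n t p) = act n t (inv \<psi> p)" if "t \<noteq> 0" for t p
    using act[OF that, of "inv \<psi> p"] by (metis inv1 inv2)
  have com: "\<psi> (mu n h p) = mu n h' (\<psi> p)" for p by (simp add: eq inv1)
  obtain f g \<alpha> \<beta> \<gamma> \<delta> Gx Hx Gy Hy where L: "linearization n \<psi> f g \<alpha> \<beta> \<gamma> \<delta> Gx Hx Gy Hy"
    using linearization_exists[OF reg(1) act odd] by blast
  obtain f' g' \<alpha>' \<beta>' \<gamma>' \<delta>' Gx' Hx' Gy' Hy' where M: "linearization n (inv \<psi>) f' g' \<alpha>' \<beta>' \<gamma>' \<delta>' Gx' Hx' Gy' Hy'"
    using linearization_exists[OF reg(2) act' odd] by blast
  \<comment> \<open>None of the three polynomials has a root, so all are constant: \<psi> acts on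
    the plane x = y = 0 by scalars, and its normal determinant is constant.\<close>
  note nz = linearization_invertible[OF L M inv1]
  obtain l where l: "f = [:l:]" "l \<noteq> 0" using constant_if_no_roots[of f] nz(1) by blast
  obtain l' where l': "g = [:l':]" using constant_if_no_roots[of g] nz(2) by blast
  obtain c where c: "\<alpha> * \<delta> - monom 1 n * \<beta> * \<gamma> = [:c:]" "c \<noteq> 0"
    using constant_if_no_roots[of "\<alpha> * \<delta> - monom 1 n * \<beta> * \<gamma>"] nz(3) by blast
  note rel = linearized_relation(2)[OF L[unfolded l(1) l'] com]
  define r where "r = norm l"
  have r: "r > 0" "l * cnj l = (of_real r)^2" using l(2) complex_norm_square[of l] by (simp_all add: r_def)
  \<comment> \<open>rescaling the normal derivative by this root of a phase makes l real and positive\<close>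
  define \<epsilon> where "\<epsilon> = csqrt ((l / of_real r)^n)"
  have eps: "l^n = \<epsilon>^2 * of_real r^n" using r(1) by (simp add: \<epsilon>_def power_divide)
  have "norm ((l / of_real r)^n) = 1" using l(2) by (simp add: norm_power norm_divide r_def)
  then have "norm (\<epsilon>^2) = 1" by (simp add: \<epsilon>_def)
  then have "norm \<epsilon> = 1" using norm_ge_zero[of \<epsilon>] by (auto simp: norm_power power2_eq_1_iff simp del: norm_ge_zero)
  then have unit: "\<epsilon> * cnj \<epsilon> = 1" using complex_norm_square[of \<epsilon>] by simp
  have eps': "cnj l^n = (cnj \<epsilon>)^2 * of_real r^n" using arg_cong[OF eps, of cnj] by simp
  have "monom 1 m dvd h - rescale r h' \<or> monom 1 m dvd h + rescale r h'"
  proof (rule fibre_classification[OF n])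
    \<comment> \<open>Multiplying the rows by \<open>cnj \<epsilon>\<close> and
      \<open>\<epsilon>\<close> keeps the determinant and absorbs the phase
      \<open>\<epsilon>^2\<close> of \<open>l^n\<close>.\<close>
    show "smult (cnj \<epsilon>) \<alpha> * smult \<epsilon> \<delta> - monom 1 n * smult (cnj \<epsilon>) \<beta> * smult \<epsilon> \<gamma> = [:c:]"
      using unit c by (simp add: mult.commute)
    show "c \<noteq> 0" by (rule c)
    fix t T H K al be ga de s s'
    assume T: "t < 0" "T = complex_of_real t"
      and H: "H = poly (map_poly complex_of_real h) T"
      and K: "K = poly (map_poly complex_of_real (rescale r h')) T"
      and "al = poly (smult (cnj \<epsilon>) \<alpha>) T" "be = poly (smult (cnj \<epsilon>) \<beta>) T"
        "ga = poly (smult \<epsilon> \<gamma>) T" "de = poly (smult \<epsilon> \<delta>) T"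
      and s: "s = (\<Sum>j<n. (T * H^2)^j)" and s': "s' = (\<Sum>j<n. (T * K^2)^j)"
    define a b c d where "a = poly \<alpha> T" "b = poly \<beta> T" "c = poly \<gamma> T" "d = poly \<delta> T"
    note abcd = this
    have vals: "al = cnj \<epsilon> * a" "be = cnj \<epsilon> * b" "ga = \<epsilon> * c" "de = \<epsilon> * d"
      by (simp_all add: abcd \<open>al = _\<close> \<open>be = _\<close> \<open>ga = _\<close> \<open>de = _\<close>)
    define T' K' where "T' = T * (l * cnj l)" and "K' = poly (map_poly complex_of_real h') T'"
    have K': "K = of_real r * K'" by (simp add: K poly_rescale K'_def T'_def r mult.commute)
    have TK: "T' * K'^2 = T * K^2" by (simp add: T'_def K' r power_mult_distrib mult_ac)
    have pw: "(l * K')^n = \<epsilon>^2 * K^n" "(cnj l * K')^n = (cnj \<epsilon>)^2 * K^n"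
      by (simp_all add: power_mult_distrib eps eps' K' mult_ac)
    define Tn Hn Kn where "Tn = T^n" "Hn = H^n" "Kn = K^n"
    note pows = this
    have 1: "a*(1-T*H^2) - Tn*b*Hn = (1-T*K^2)*cnj d + Tn*cnj b*(\<epsilon>^2*Kn)"
      and 2: "a*Hn + b*s = (1-T*K^2)*cnj c + \<epsilon>^2*Kn*cnj a"
      and 3: "Tn*c*(1-T*H^2) - Tn*d*Hn = Tn*s'*cnj b - Tn*((cnj \<epsilon>)^2*Kn)*cnj d"
      and 4: "Tn*c*Hn + d*s = s'*cnj a - Tn*((cnj \<epsilon>)^2*Kn)*cnj c"
      using rel[OF T(2) H T'_def K'_def abcd s s'[folded TK]] unfolding TK pw pows by blast+
    define e ca cb cc cd where "e = cnj \<epsilon>" "ca = cnj a" "cb = cnj b" "cc = cnj c" "cd = cnj d"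
    note conjs = this
    have ce: "cnj e = \<epsilon>" by (simp add: conjs)
    have "e*a*(1-T*H^2) - Tn*(e*b)*Hn = (1-T*K^2)*(e*cd) + Tn*(\<epsilon>*cb)*Kn"
      using 1 unit unfolding conjs[symmetric] by algebra
    moreover have "e*a*Hn + e*b*s = (1-T*K^2)*(e*cc) + Kn*(\<epsilon>*ca)"
      using 2 unit unfolding conjs[symmetric] by algebra
    moreover have "Tn*(\<epsilon>*c)*(1-T*H^2) - Tn*(\<epsilon>*d)*Hn = Tn*s'*(\<epsilon>*cb) - Tn*Kn*(e*cd)"
      using 3 unit unfolding conjs[symmetric] by algebra
    moreover have "Tn*(\<epsilon>*c)*Hn + \<epsilon>*d*s = s'*(\<epsilon>*ca) - Tn*Kn*(e*cc)"
      using 4 unit unfolding conjs[symmetric] by algebra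
    ultimately show "al*(1-T*H^2) - T^n*be*H^n = (1-T*K^2)*cnj de + T^n*cnj be*K^n \<and>
       al*H^n + be*s = (1-T*K^2)*cnj ga + K^n*cnj al \<and>
       T^n*ga*(1-T*H^2) - T^n*de*H^n = T^n*s'*cnj be - T^n*K^n*cnj de \<and>
       T^n*ga*H^n + de*s = s'*cnj al - T^n*K^n*cnj ga"
      unfolding vals by (simp add: ce flip: conjs pows)
  qed
  \<comment> \<open>\<open>rescale\<close> is odd in its first argument, so the remaining sign is
    absorbed by passing from \<open>r\<close> to \<open>-r\<close>.\<close>
  moreover have "h + rescale r h' = h - rescale (- r) h'" by (simp add: rescale_def)
  ultimately show ?thesis using r(1) by (metis less_numeral_extra(3) monom_altdef neg_equal_0_iff_equal smult_1_left)
qed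

theorem theorem3p1:
  fixes m :: nat and n :: nat and h h' :: "real poly"
  assumes "m \<ge> 1" and "n = 2 * m + 1"
  shows "real_circle_form n (mu n h) \<and>
         (equivalent_forms n (mu n h) (mu n h') \<longleftrightarrow>
           (\<exists>r::real. r \<noteq> 0 \<and>
              [:0, 1:] ^ m dvd (h - smult r (pcompose h' [:0, r^2:]))))"
proof -
  have "odd n" using assms(2) by simp
  then show ?thesis
    using real_circle_form_mu equivalent_mu[OF assms(2)] equivalent_mu_necessary[OF assms(2)]
    unfolding rescale_def by blast
qed

end
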